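(* For every BST $T$ on $n$ keys there is a query sequence $S(T)$ with $$|S(T)|\le\min\Big(3n\big(d(T)-\lfloor\lg n\rfloor+1\big),\ \tfrac32 n(n-1)\Big),$$ in particular $|S(T)|=O(n\cdot d(T))$, such that the following holds. For every initial BST $T_0$ on the same keys and every query sequence $Y$, when $GF$ serves the concatenation $S(T)\circ Y$ starting from $T_0$, the tree it holds right after serving the last query of $S(T)$ is exactly $T$.
   Context: $d(T)$ is the maximum, over nodes $v$, of the number of edges from the root to $v$. $\lg$ is the base-2 logarithm. Binary search tree model. An algorithm serving a query sequence $X=[x_1,\dots,x_m]$ holds a BST $T_{t-1}$ before serving $x_t$, searches $x_t$ from the root, and may then restructure by rotations into $T_t$. Greedy Future ($GF$). After finding $x_t$ in $T_{t-1}$, let $v_1<\dots<v_k$ be the keys on the root-to-$x_t$ path, set $v_0=-\infty$ and $v_{k+1}=+\infty$, and let $R_0,\dots,R_k$ be the subtrees hanging off this path. For each $i$, $\tau(v_i)$ is the smallest $s>t$ with $x_s\in(v_{i-1},v_{i+1})$, or $+\infty$ if there is none. $GF$ rearranges $v_1,\dots,v_k$ as a treap: a BST in key order and a heap in $\tau$, with the smallest $\tau$ at the top. Ties in $\tau$ are broken in favor of the node of smaller depth in $T_{t-1}$. It then reattaches $R_0,\dots,R_k$ unchanged at their unique positions, giving $T_t$. *)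

theory Defs
  imports Complex_Main "HOL-Library.Tree" "HOL-Library.Extended_Nat" "HOL-Library.Product_Lexorder"
begin

(* d(T): max number of edges from root to a node (for nonempty T) *)
definition depth_tree :: "'a tree \<Rightarrow> nat" where
  "depth_tree t = height t - 1"

(* frame d T x = (vs, Rs): vs = keys on the root-to-x search path in increasing key order,
   each paired with its depth in T (root has depth d);
   Rs = the subtrees R_0,...,R_k hanging off the path, in key order (length vs + 1). *)
fun frame :: "nat \<Rightarrow> 'a::linorder tree \<Rightarrow> 'a \<Rightarrow> ('a \<times> nat) list \<times> 'a tree list" where
  "frame d Leaf x = ([], [Leaf])"
| "frame d (Node l a r) x =
     (if x = a then ([(a, d)], [l, r])
      else if x < a then (let (vs, Rs) = frame (Suc d) l x in (vs @ [(a, d)], Rs @ [r]))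
      else (let (vs, Rs) = frame (Suc d) r x in ((a, d) # vs, l # Rs)))"

definition in_open :: "'a::linorder option \<Rightarrow> 'a option \<Rightarrow> 'a \<Rightarrow> bool" where
  "in_open lo hi y = ((case lo of None \<Rightarrow> True | Some a \<Rightarrow> a < y) \<and>
                       (case hi of None \<Rightarrow> True | Some b \<Rightarrow> y < b))"

fun first_in :: "('a \<Rightarrow> bool) \<Rightarrow> 'a list \<Rightarrow> enat" where
  "first_in P [] = \<infinity>"
| "first_in P (y # ys) = (if P y then 0 else eSuc (first_in P ys))"

definition min_idx :: "'b::linorder list \<Rightarrow> nat" where
  "min_idx xs = (LEAST i. i < length xs \<and> (\<forall>j<length xs. xs ! i \<le> xs ! j))"

(* treap construction: keys (sorted) with priorities, subtrees R_0..R_k to hang;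
   the first argument is fuel (called with length of the key list, which suffices) *)
fun build :: "nat \<Rightarrow> ('a \<times> 'p::linorder) list \<Rightarrow> 'a tree list \<Rightarrow> 'a tree" where
  "build 0 vs Rs = hd Rs"
| "build (Suc n) vs Rs =
     (if vs = [] then hd Rs
      else (let i = min_idx (map snd vs) in
            Node (build n (take i vs) (take (Suc i) Rs)) (fst (vs ! i))
                 (build n (drop (Suc i) vs) (drop (Suc i) Rs))))"

(* One step of Greedy Future: current tree T, query x = x_t, future queries fut = [x_{t+1},...].
   tau(v_i) is represented by its offset in fut (offset j means time t+1+j; infinity if none);
   priority = (tau, depth in T), compared lexicographically, smaller at the top. *)
definition gf_step :: "'a::linorder tree \<Rightarrow> 'a \<Rightarrow> 'a list \<Rightarrow> 'a tree" where
  "gf_step T x fut =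
     (let (vs, Rs) = frame 0 T x;
          k = length vs;
          lo = (\<lambda>i. if i = 0 then None else Some (fst (vs ! (i - 1))));
          hi = (\<lambda>i. if Suc i < k then Some (fst (vs ! Suc i)) else None);
          pr = map (\<lambda>i. (fst (vs ! i), (first_in (in_open (lo i) (hi i)) fut, snd (vs ! i)))) [0..<k]
      in build k pr Rs)"

fun gf_serve :: "'a::linorder tree \<Rightarrow> 'a list \<Rightarrow> nat \<Rightarrow> 'a tree" where
  "gf_serve T X 0 = T"
| "gf_serve T [] (Suc m) = T"
| "gf_serve T (x # xs) (Suc m) = gf_serve (gf_step T x xs) xs m"

end

theory Submission
  imports Defs
begin

text \<open>
  Record for every key the time \<open>\<rho>\<close> of its last touch. The tree held by Greedy Future is always
  heap-ordered by \<open>\<rho>\<close>, with ties resolved by the next time at which a key will be touched; hence it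
  equals \<open>T\<close> as soon as \<open>\<rho>\<close> strictly decreases along every edge of \<open>T\<close>, whatever the later queries are.

  To force this, first query every non-leaf of \<open>T\<close> twice, from right to left. Afterwards \<open>\<rho>\<close> is
  strictly decreasing in key order on the non-leaves, and every leaf is shielded by its neighbours, so
  that it is not touched any more. Then remove the non-leaves in postorder: two queries (one for a lowest
  non-leaf, three for a node with only a right non-leaf child) touch a node together with its two
  remaining neighbours, after which these shield it from all further queries.

  With \<open>I\<close> non-leaves, \<open>L\<close> leaves and \<open>P\<close> lowest non-leaves this takes at most \<open>5I + 1 - 3P\<close> queries.
  If \<open>2^d \<le> n\<close>, then \<open>I + 1 \<le> 2^(d-1) + P\<close> and \<open>P \<le> L\<close> bound this by \<open>3n\<close>; otherwise
  \<open>6n\<close> queries are allowed.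
\<close>

section \<open>Greedy Future and last touch times\<close>

text \<open>The segment from the query \<open>x\<close> towards \<open>y\<close>, on either side. It
  is closed at \<open>x\<close>, so that the queried key itself can block \<open>y\<close>, and open
  at \<open>y\<close>.\<close>

definition between :: "'a::linorder \<Rightarrow> 'a \<Rightarrow> 'a \<Rightarrow> bool" where
  "between x y z \<longleftrightarrow> x \<le> z \<and> z < y \<or> y < z \<and> z \<le> x"

text \<open>\<open>\<rho> y\<close> is the last time at which \<open>y\<close> was on a search path. In the geometric view of Greedy, a
query \<open>x\<close> touches exactly the strict records of \<open>\<rho>\<close> seen when walking away from \<open>x\<close> on either side.\<close>

definition touched :: "'a::linorder set \<Rightarrow> ('a \<Rightarrow> nat) \<Rightarrow> 'a \<Rightarrow> 'a \<Rightarrow> bool" where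
  "touched K \<rho> x y \<longleftrightarrow> y \<in> K \<and> (\<forall>z\<in>K. between x y z \<longrightarrow> \<rho> z < \<rho> y)"

definition touch :: "'a::linorder set \<Rightarrow> nat \<Rightarrow> ('a \<Rightarrow> nat) \<Rightarrow> 'a \<Rightarrow> 'a \<Rightarrow> nat" where
  "touch K t \<rho> x = (\<lambda>y. if touched K \<rho> x y then t else \<rho> y)"

fun run :: "'a::linorder set \<Rightarrow> nat \<Rightarrow> ('a \<Rightarrow> nat) \<Rightarrow> 'a list \<Rightarrow> 'a \<Rightarrow> nat" where
  "run K t \<rho> [] = \<rho>"
| "run K t \<rho> (x # xs) = run K (Suc t) (touch K (Suc t) \<rho> x) xs"

section \<open>Heap-ordered search trees\<close>

fun heap_wrt :: "('a \<Rightarrow> 'a \<Rightarrow> bool) \<Rightarrow> 'a tree \<Rightarrow> bool" where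
  "heap_wrt le Leaf \<longleftrightarrow> True"
| "heap_wrt le (Node l a r) \<longleftrightarrow>
     heap_wrt le l \<and> heap_wrt le r \<and> (\<forall>z\<in>set_tree l \<union> set_tree r. le a z)"

lemma heap_mono:
  assumes "heap_wrt le t" "\<And>a z. a \<in> set_tree t \<Longrightarrow> z \<in> set_tree t \<Longrightarrow> le a z \<Longrightarrow> le' a z"
  shows "heap_wrt le' t"
  using assms by (induction t) auto

text \<open>If the roots differed, each would be a proper descendant of the other, and the strict
  inequality in \<open>t\<close> would contradict the weak one in \<open>s\<close>. Equal roots
  split the keys equally. Strictness in \<open>t\<close> alone suffices, so ties of \<rho> may be
  resolved in \<open>s\<close> in any way.\<close>

lemma heap_bst_unique:
  fixes \<rho> :: "'a::linorder \<Rightarrow> nat"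
  assumes "bst t" "bst s" "set_tree s = set_tree t"
    "heap_wrt (\<lambda>a z. \<rho> z \<le> \<rho> a) s" "heap_wrt (\<lambda>a z. \<rho> z < \<rho> a) t"
  shows "s = t"
  using assms
proof (induction t arbitrary: s)
  case Leaf
  then show ?case by simp
next
  case (Node l a r)
  obtain l' a' r' where s: "s = Node l' a' r'"
    using Node.prems(3) by (cases s) auto
  have "a' = a"
  proof (rule ccontr)
    assume "a' \<noteq> a"
    then have "a' \<in> set_tree l \<union> set_tree r" "a \<in> set_tree l' \<union> set_tree r'"
      using Node.prems(3) s by auto
    then have "\<rho> a' < \<rho> a" "\<rho> a \<le> \<rho> a'"
      using Node.prems(4,5) s by auto
    then show False by simp
  qed
  have "set_tree l' = {x \<in> set_tree s. x < a}" "set_tree r' = {x \<in> set_tree s. a < x}"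
    using Node.prems(2) s \<open>a' = a\<close> by (auto dest: less_asym)
  moreover have "set_tree l = {x \<in> set_tree s. x < a}" "set_tree r = {x \<in> set_tree s. a < x}"
    using Node.prems(1,3) by (auto dest: less_asym)
  ultimately have eq: "set_tree l' = set_tree l" "set_tree r' = set_tree r"
    by simp_all
  have "l' = l"
    by (rule Node.IH(1)) (use Node.prems s eq in simp_all)
  moreover have "r' = r"
    by (rule Node.IH(2)) (use Node.prems s eq in simp_all)
  ultimately show ?case using s \<open>a' = a\<close> by simp
qed

text \<open>Supplies a fictitious past for the initial tree: last touch times under which it is
  already heap-ordered.\<close>

lemma ex_strict_heap:
  assumes "bst t"
  shows "\<exists>\<rho> :: 'a::linorder \<Rightarrow> nat. heap_wrt (\<lambda>a z. \<rho> z < \<rho> a) t"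
  using assms
proof (induction t)
  case Leaf
  then show ?case by simp
next
  case (Node l a r)
  obtain \<rho>l \<rho>r :: "'a \<Rightarrow> nat" where l: "heap_wrt (\<lambda>a z. \<rho>l z < \<rho>l a) l" and r: "heap_wrt (\<lambda>a z. \<rho>r z < \<rho>r a) r"
    using Node by auto
  \<comment> \<open>With both subtrees empty, \<open>Max {}\<close> is unspecified, but then the
    bounds by \<open>M\<close> are vacuous.\<close>
  define M where "M = Suc (Max (\<rho>l ` set_tree l \<union> \<rho>r ` set_tree r))"
  have M: "z \<in> set_tree l \<Longrightarrow> \<rho>l z < M" "z \<in> set_tree r \<Longrightarrow> \<rho>r z < M" for z
    unfolding M_def by (auto simp: less_Suc_eq_le intro!: Max_ge)
  define \<rho> where "\<rho> z = (if z < a then \<rho>l z else if z = a then M else \<rho>r z)" for z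
  have "heap_wrt (\<lambda>a z. \<rho> z < \<rho> a) l"
    by (rule heap_mono[OF l]) (use Node.prems in \<open>auto simp: \<rho>_def\<close>)
  moreover have "heap_wrt (\<lambda>a z. \<rho> z < \<rho> a) r"
    by (rule heap_mono[OF r]) (use Node.prems in \<open>auto simp: \<rho>_def dest: less_asym\<close>)
  moreover have "\<forall>z\<in>set_tree l \<union> set_tree r. \<rho> z < \<rho> a"
    using Node.prems M by (auto simp: \<rho>_def dest: less_asym)
  ultimately show ?case by auto
qed

section \<open>Search paths and touched keys\<close>

lemma fst_frame_Node:
  "fst (frame d (Node l a r) x) =
     (if x = a then [(a, d)]
      else if x < a then fst (frame (Suc d) l x) @ [(a, d)]
      else (a, d) # fst (frame (Suc d) r x))"
  by (simp add: split_beta)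

lemma snd_frame_Node:
  "snd (frame d (Node l a r) x) =
     (if x = a then [l, r]
      else if x < a then snd (frame (Suc d) l x) @ [r]
      else l # snd (frame (Suc d) r x))"
  by (simp add: split_beta)

fun path :: "'a::linorder tree \<Rightarrow> 'a \<Rightarrow> 'a list" where
  "path Leaf x = []"
| "path (Node l a r) x =
     (if x = a then [a] else if x < a then path l x @ [a] else a # path r x)"

lemma map_fst_frame: "map fst (fst (frame d t x)) = path t x"
  by (induction t arbitrary: d) (simp_all add: fst_frame_Node del: frame.simps(2))

lemma set_path_subset: "set (path t x) \<subseteq> set_tree t"
  by (induction t) auto

text \<open>Every proper ancestor of a path node \<open>y\<close> has \<open>x\<close> and
  \<open>y\<close> strictly on the same side, hence also every key between them. So those keys all
  lie in the subtree of \<open>y\<close>.\<close>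

lemma path_heap_le:
  assumes "bst t" "heap_wrt le t" "y \<in> set (path t x)" "z \<in> set_tree t" "between x y z"
  shows "le y z"
  using assms
proof (induction t)
  case Leaf
  then show ?case by simp
next
  case (Node l a r)
  show ?case
  proof (cases "y = a")
    case True
    then show ?thesis using Node.prems(2,4,5) by (auto simp: between_def)
  next
    case False
    consider "x < a" "y \<in> set (path l x)" | "a < x" "y \<in> set (path r x)"
      using Node.prems(3) False by (auto split: if_splits)
    then show ?thesis
    proof cases
      case 1
      then have "y < a" using set_path_subset[of l x] Node.prems(1) by auto
      then have "z < a" using 1 Node.prems(5) by (auto simp: between_def)
      then have "z \<in> set_tree l" using Node.prems(1,4) by (auto dest: less_asym)
      then show ?thesis using Node.IH(1)[OF _ _ 1(2)] Node.prems by simp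
    next
      case 2
      then have "a < y" using set_path_subset[of r x] Node.prems(1) by auto
      then have "a < z" using 2 Node.prems(5) by (auto simp: between_def)
      then have "z \<in> set_tree r" using Node.prems(1,4) by (auto dest: less_asym)
      then show ?thesis using Node.IH(2)[OF _ _ 2(2)] Node.prems by simp
    qed
  qed
qed

text \<open>The witness is the node at which the searches for \<open>x\<close> and \<open>y\<close>
  part: it is an ancestor of \<open>y\<close> and separates \<open>y\<close> from \<open>x\<close>,
  or is \<open>x\<close> itself.\<close>

lemma not_path_heap_le:
  assumes "bst t" "heap_wrt le t" "y \<in> set_tree t" "y \<notin> set (path t x)"
  shows "\<exists>w\<in>set_tree t. between x y w \<and> le w y"
  using assms
proof (induction t)
  case Leaf
  then show ?case by simp
next
  case (Node l a r)
  have ya: "y \<noteq> a" using Node.prems(4) by (auto split: if_splits)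
  then have le: "le a y" using Node.prems(2,3) by auto
  show ?case
  proof (cases "between x y a")
    case True
    then show ?thesis using le by auto
  next
    case False
    then consider "x < a" "y < a" | "a < x" "a < y"
      using ya by (auto simp: between_def not_less not_le)
    then show ?thesis
    proof cases
      case 1
      then have "y \<in> set_tree l" using Node.prems(1,3) by (auto dest: less_asym)
      moreover have "y \<notin> set (path l x)"
        using Node.prems(4) 1 by (auto split: if_splits)
      ultimately show ?thesis using Node.IH(1) Node.prems(1,2) by auto
    next
      case 2
      then have "y \<in> set_tree r" using Node.prems(1,3) by (auto dest: less_asym)
      moreover have "y \<notin> set (path r x)"
        using Node.prems(4) 2 by (auto split: if_splits)
      ultimately show ?thesis using Node.IH(2) Node.prems(1,2) by auto
    qed
  qed
qed

text \<open>The set of queries touching \<open>y\<close> does not change until \<open>y\<close> is touched again, so \<open>wait\<close> decreases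
by exactly one with every query that leaves \<open>y\<close> alone. Right after \<open>y\<close> is touched it is the \<open>\<tau>\<close> of Greedy Future.\<close>

definition wait :: "'a::linorder set \<Rightarrow> ('a \<Rightarrow> nat) \<Rightarrow> 'a list \<Rightarrow> 'a \<Rightarrow> enat" where
  "wait K \<rho> fut y = first_in (\<lambda>x. touched K \<rho> x y) fut"

text \<open>All nodes of one search path receive the same time, so \<rho> alone does not describe
  the tree. Ties in both components are left open, so the depth rule of Greedy Future needs no
  counterpart.\<close>

definition prior :: "'a::linorder set \<Rightarrow> ('a \<Rightarrow> nat) \<Rightarrow> 'a list \<Rightarrow> 'a \<Rightarrow> 'a \<Rightarrow> bool" where
  "prior K \<rho> fut y z \<longleftrightarrow> \<rho> z < \<rho> y \<or> \<rho> z = \<rho> y \<and> wait K \<rho> fut y \<le> wait K \<rho> fut z"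

lemma first_in_zero_iff: "first_in P (x # xs) = 0 \<longleftrightarrow> P x"
  by simp

text \<open>Among the ties on the way from \<open>x\<close> to a path node \<open>y\<close>, the one closest to \<open>x\<close> is touched by \<open>x\<close>,
hence has waiting time 0; since \<open>y\<close> is its ancestor, so has \<open>y\<close>.\<close>

lemma set_path_eq_touched:
  assumes "bst t" "heap_wrt (prior (set_tree t) \<rho> (x # fut)) t"
  shows "set (path t x) = {y. touched (set_tree t) \<rho> x y}"
proof (intro equalityI subsetI CollectI)
  fix y assume y: "y \<in> set (path t x)"
  let ?K = "set_tree t"
  have yK: "y \<in> ?K" using y set_path_subset by blast
  show "touched ?K \<rho> x y"
  proof (rule ccontr)
    assume nt: "\<not> touched ?K \<rho> x y"
    define Z where "Z = {z \<in> ?K. between x y z \<and> \<rho> y \<le> \<rho> z}"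
    have Z: "finite Z" "Z \<noteq> {}"
      using nt yK by (auto simp: Z_def touched_def not_less)
    have eq: "\<rho> z = \<rho> y" "wait ?K \<rho> (x # fut) y \<le> wait ?K \<rho> (x # fut) z" if "z \<in> Z" for z
      using path_heap_le[OF assms y, of z] that by (auto simp: Z_def prior_def)
    have "\<exists>z\<in>Z. touched ?K \<rho> x z"
    proof (cases "x < y")
      case True
      have m: "Min Z \<in> Z" using Z by simp
      have "\<rho> w < \<rho> (Min Z)" if "w \<in> ?K" "between x (Min Z) w" for w
      proof (rule ccontr)
        assume "\<not> ?thesis"
        then have "w \<in> Z" using that m True eq[OF m] by (auto simp: Z_def between_def)
        then have "Min Z \<le> w" using Z by simp
        then show False using that True m by (auto simp: between_def Z_def)
      qed
      then show ?thesis using m by (auto simp: touched_def Z_def)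
    next
      case False
      have m: "Max Z \<in> Z" using Z by simp
      have "\<rho> w < \<rho> (Max Z)" if "w \<in> ?K" "between x (Max Z) w" for w
      proof (rule ccontr)
        assume "\<not> ?thesis"
        then have "w \<in> Z" using that m False eq[OF m] by (auto simp: Z_def between_def)
        then have "w \<le> Max Z" using Z by simp
        then show False using that False m by (auto simp: between_def Z_def)
      qed
      then show ?thesis using m by (auto simp: touched_def Z_def)
    qed
    then obtain z where "z \<in> Z" "wait ?K \<rho> (x # fut) z = 0"
      by (auto simp: wait_def)
    then have "wait ?K \<rho> (x # fut) y = 0" using eq by force
    then show False using nt by (simp only: wait_def first_in_zero_iff)
  qed
next
  fix y assume "y \<in> {y. touched (set_tree t) \<rho> x y}"
  then have y: "touched (set_tree t) \<rho> x y" by simp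
  show "y \<in> set (path t x)"
  proof (rule ccontr)
    assume "y \<notin> set (path t x)"
    \<comment> \<open>An untouched path would leave an ancestor \<open>w\<close> of \<open>y\<close>
      on the way from \<open>x\<close>, touched no earlier than \<open>y\<close>; it blocks
      \<open>y\<close>.\<close>
    then obtain w where "w \<in> set_tree t" "between x y w" "prior (set_tree t) \<rho> (x # fut) w y"
      using not_path_heap_le[OF assms, of y] y by (auto simp: touched_def)
    then show False using y by (fastforce simp: touched_def prior_def)
  qed
qed

section \<open>Rebuilding the search path as a treap\<close>

fun weave :: "'a list \<Rightarrow> 'a tree list \<Rightarrow> 'a list" where
  "weave [] Rs = inorder (hd Rs)"
| "weave (v # vs) Rs = inorder (hd Rs) @ v # weave vs (tl Rs)"

lemma weave_snoc:
  "length Rs = Suc (length vs) \<Longrightarrow> weave (vs @ [v]) (Rs @ [R]) = weave vs Rs @ v # inorder R"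
proof (induction vs arbitrary: Rs)
  case Nil
  then show ?case by (cases Rs) auto
next
  case (Cons v vs)
  then show ?case by (cases Rs) auto
qed

lemma length_snd_frame: "length (snd (frame d t x)) = Suc (length (path t x))"
  by (induction t arbitrary: d) (simp_all add: snd_frame_Node del: frame.simps(2))

lemma weave_frame: "weave (path t x) (snd (frame d t x)) = inorder t"
  by (induction t arbitrary: d)
    (simp_all add: snd_frame_Node weave_snoc length_snd_frame del: frame.simps(2))

lemma weave_split:
  assumes "i < length vs" "length Rs = Suc (length vs)"
  shows "weave vs Rs = weave (take i vs) (take (Suc i) Rs) @ vs ! i #
           weave (drop (Suc i) vs) (drop (Suc i) Rs)"
  using assms
proof (induction vs arbitrary: i Rs)
  case (Cons v vs)
  then obtain R Rs' where "Rs = R # Rs'" by (cases Rs) auto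
  then show ?case using Cons by (cases i) auto
qed simp

lemma set_weave:
  "length Rs = Suc (length vs) \<Longrightarrow> set (weave vs Rs) = set vs \<union> (\<Union>R\<in>set Rs. set_tree R)"
proof (induction vs arbitrary: Rs)
  case Nil
  then show ?case by (cases Rs) auto
next
  case (Cons v vs)
  then show ?case by (cases Rs) auto
qed

lemma sorted_weave:
  "sorted_wrt (<) (weave vs Rs) \<Longrightarrow> length Rs = Suc (length vs) \<Longrightarrow> sorted_wrt (<) vs"
proof (induction vs arbitrary: Rs)
  case (Cons v vs)
  then obtain R0 Rs' where "Rs = R0 # Rs'" by (cases Rs) auto
  then show ?case using Cons by (auto simp: sorted_wrt_append set_weave)
qed simp

lemma distinct_weave_disjoint:
  "distinct (weave vs Rs) \<Longrightarrow> length Rs = Suc (length vs) \<Longrightarrow> R \<in> set Rs \<Longrightarrow> set_tree R \<inter> set vs = {}"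
proof (induction vs arbitrary: Rs)
  case (Cons v vs)
  then obtain R0 Rs' where Rs: "Rs = R0 # Rs'" by (cases Rs) auto
  have "set (weave vs Rs') = set vs \<union> (\<Union>R\<in>set Rs'. set_tree R)"
    using Cons.prems(2) Rs by (simp add: set_weave)
  then show ?case using Cons.IH[of Rs'] Cons.prems Rs by auto
qed simp

lemma min_idx:
  fixes xs :: "'b::linorder list"
  assumes "xs \<noteq> []"
  shows "min_idx xs < length xs \<and> (\<forall>j<length xs. xs ! min_idx xs \<le> xs ! j)"
proof -
  obtain i where "i < length xs" "xs ! i = Min (set xs)"
    using assms Min_in[of "set xs"] by (auto simp: in_set_conv_nth)
  then have "i < length xs \<and> (\<forall>j<length xs. xs ! i \<le> xs ! j)" by auto
  then show ?thesis unfolding min_idx_def by (rule LeastI)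
qed

text \<open>The frame of a tree and the treap built from it flatten to the same
  \<open>weave\<close>, so restructuring preserves the inorder list. Each level removes at least one
  key, so fuel equal to the number of keys suffices.\<close>

lemma inorder_build:
  assumes "length vs \<le> n" "length Rs = Suc (length vs)"
  shows "inorder (build n vs Rs) = weave (map fst vs) Rs"
  using assms
proof (induction n arbitrary: vs Rs)
  case (Suc n)
  show ?case
  proof (cases "vs = []")
    case False
    define i where "i = min_idx (map snd vs)"
    have i: "i < length vs" using min_idx[of "map snd vs"] False by (simp add: i_def)
    show ?thesis
      using Suc i False weave_split[of i "map fst vs" Rs]
      by (simp add: i_def[symmetric] Let_def take_map drop_map)
  qed simp
qed simp

text \<open>Isolates what the treap needs of \<open>le\<close>. A root has minimal priority among
  its path keys, and every other key below it is a path key or lies in a hanging subtree. Since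
  \<open>heap_wrt\<close> speaks of all descendants, \<open>le\<close> is not assumed
  transitive.\<close>

lemma heap_build:
  assumes "length vs \<le> n" "length Rs = Suc (length vs)"
    and "\<And>R. R \<in> set Rs \<Longrightarrow> heap_wrt le R"
    and "\<And>v R z. v \<in> fst ` set vs \<Longrightarrow> R \<in> set Rs \<Longrightarrow> z \<in> set_tree R \<Longrightarrow> le v z"
    and "\<And>v w p q. (v, p) \<in> set vs \<Longrightarrow> (w, q) \<in> set vs \<Longrightarrow> p \<le> q \<Longrightarrow> le v w"
  shows "heap_wrt le (build n vs Rs)"
  using assms
proof (induction n arbitrary: vs Rs)
  case 0
  then show ?case by (auto simp: length_Suc_conv)
next
  case (Suc n)
  show ?case
  proof (cases "vs = []")
    case True
    then show ?thesis using Suc by (auto simp: length_Suc_conv)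
  next
    case False
    define i where "i = min_idx (map snd vs)"
    have i: "i < length vs" and min: "\<And>j. j < length vs \<Longrightarrow> snd (vs ! i) \<le> snd (vs ! j)"
      using min_idx[of "map snd vs"] False by (auto simp: i_def)
    let ?l = "build n (take i vs) (take (Suc i) Rs)"
    let ?r = "build n (drop (Suc i) vs) (drop (Suc i) Rs)"
    have sub: "set (take i vs) \<subseteq> set vs" "set (drop (Suc i) vs) \<subseteq> set vs"
      "set (take (Suc i) Rs) \<subseteq> set Rs" "set (drop (Suc i) Rs) \<subseteq> set Rs"
      by (simp_all add: set_take_subset set_drop_subset)
    have "heap_wrt le ?l"
    proof (rule Suc.IH)
      show "length (take i vs) \<le> n" "length (take (Suc i) Rs) = Suc (length (take i vs))"
        using Suc.prems(1,2) i by auto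
      show "heap_wrt le R" if "R \<in> set (take (Suc i) Rs)" for R
        using Suc.prems(3) that sub by blast
      show "le v z" if "v \<in> fst ` set (take i vs)" "R \<in> set (take (Suc i) Rs)" "z \<in> set_tree R" for v R z
        using Suc.prems(4) that sub by blast
      show "le v w" if "(v, p) \<in> set (take i vs)" "(w, q) \<in> set (take i vs)" "p \<le> q" for v w p q
        using Suc.prems(5) that sub by blast
    qed
    moreover have "heap_wrt le ?r"
    proof (rule Suc.IH)
      show "length (drop (Suc i) vs) \<le> n" "length (drop (Suc i) Rs) = Suc (length (drop (Suc i) vs))"
        using Suc.prems(1,2) i by auto
      show "heap_wrt le R" if "R \<in> set (drop (Suc i) Rs)" for R
        using Suc.prems(3) that sub by blast
      show "le v z" if "v \<in> fst ` set (drop (Suc i) vs)" "R \<in> set (drop (Suc i) Rs)" "z \<in> set_tree R" for v R z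
        using Suc.prems(4) that sub by blast
      show "le v w" if "(v, p) \<in> set (drop (Suc i) vs)" "(w, q) \<in> set (drop (Suc i) vs)" "p \<le> q" for v w p q
        using Suc.prems(5) that sub by blast
    qed
    moreover have "le (fst (vs ! i)) z" if "z \<in> set_tree ?l \<union> set_tree ?r" for z
    proof -
      have "z \<in> set (inorder (build (Suc n) vs Rs))"
        using that False by (auto simp: i_def[symmetric] Let_def)
      then have "z \<in> fst ` set vs \<union> (\<Union>R\<in>set Rs. set_tree R)"
        using Suc.prems(1,2) by (subst (asm) inorder_build) (auto simp: set_weave)
      then show ?thesis
      proof
        assume "z \<in> fst ` set vs"
        then obtain j where j: "j < length vs" "z = fst (vs ! j)"
          by (auto simp: in_set_conv_nth)
        show ?thesis
          unfolding j(2) by (rule Suc.prems(5)[OF _ _ min[OF j(1)]]) (use i j(1) in simp_all)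
      next
        assume "z \<in> (\<Union>R\<in>set Rs. set_tree R)"
        moreover have "fst (vs ! i) \<in> fst ` set vs" using i by simp
        ultimately show ?thesis using Suc.prems(4) by blast
      qed
    qed
    ultimately show ?thesis
      using False by (simp add: i_def[symmetric] Let_def)
  qed
qed

section \<open>One step of Greedy Future\<close>

lemma heap_frame: "heap_wrt le t \<Longrightarrow> R \<in> set (snd (frame d t x)) \<Longrightarrow> heap_wrt le R"
  by (induction t arbitrary: d)
    (auto simp: snd_frame_Node simp del: frame.simps(2) split: if_splits)

text \<open>Forwards, times only grow while that of \<open>a\<close> stays. Backwards, no key
  between \<open>q\<close> and \<open>a\<close> can have been raised by the query \<open>x\<close>,
  as whatever blocked \<open>a\<close> would also have blocked that key.\<close>

lemma touched_touch_iff: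
  assumes "\<And>z. z \<in> K \<Longrightarrow> \<rho> z \<le> t" "a \<in> K" "\<not> touched K \<rho> x a"
  shows "touched K (touch K (Suc t) \<rho> x) q a \<longleftrightarrow> touched K \<rho> q a"
proof
  assume r: "touched K (touch K (Suc t) \<rho> x) q a"
  have "\<rho> z < \<rho> a" if "z \<in> K" "between q a z" for z
  proof -
    have "\<rho> z \<le> touch K (Suc t) \<rho> x z"
      using assms(1)[OF that(1)] by (simp add: touch_def)
    also have "\<dots> < touch K (Suc t) \<rho> x a"
      using r that unfolding touched_def by blast
    also have "\<dots> = \<rho> a" using assms(3) by (simp add: touch_def)
    finally show ?thesis .
  qed
  then show "touched K \<rho> q a" using assms(2) by (simp add: touched_def)
next
  assume l: "touched K \<rho> q a"
  have "\<not> touched K \<rho> x z" if z: "z \<in> K" "between q a z" for z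
  proof
    assume tz: "touched K \<rho> x z"
    have lt: "\<rho> z < \<rho> a" using l z by (auto simp: touched_def)
    obtain w where w: "w \<in> K" "between x a w" "\<rho> a \<le> \<rho> w"
      using assms(2,3) by (auto simp: touched_def not_less)
    \<comment> \<open>If \<open>x\<close> is on the same side of \<open>a\<close> as
      \<open>q\<close>, then \<open>w\<close> lies beyond \<open>q\<close>, hence between
      \<open>x\<close> and \<open>z\<close>, and blocks \<open>z\<close>. If it is on the other
      side, \<open>a\<close> itself lies between \<open>x\<close> and \<open>z\<close> and blocks
      it.\<close>
    have "\<not> between q a w" using l w by (auto simp: touched_def)
    moreover have "\<not> between x z a" using tz lt assms(2) by (auto simp: touched_def)
    moreover have "\<not> between x z w" using tz lt w by (auto simp: touched_def)
    ultimately show False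
      using w(2,3) z(2) lt by (auto simp: between_def not_less not_le)
  qed
  then have "touch K (Suc t) \<rho> x z < touch K (Suc t) \<rho> x a" if "z \<in> K" "between q a z" for z
    using l assms(3) that unfolding touch_def by (auto simp: touched_def)
  then show "touched K (touch K (Suc t) \<rho> x) q a"
    using assms(2) by (simp add: touched_def)
qed

lemma gf_step_inorder: "inorder (gf_step T x fut) = inorder T"
proof -
  obtain vs Rs where f: "frame 0 T x = (vs, Rs)" by fastforce
  have vs: "map fst vs = path T x" using map_fst_frame[of 0 T x] f by simp
  have Rs: "length Rs = Suc (length vs)" "weave (map fst vs) Rs = inorder T"
    using length_snd_frame[of 0 T x] weave_frame[of T x 0] f vs[symmetric] by simp_all
  have "map (\<lambda>i. fst (vs ! i)) [0..<length vs] = map fst vs"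
    by (rule nth_equalityI) simp_all
  then show ?thesis
    unfolding gf_step_def f Let_def split
    by (subst inorder_build) (use Rs in \<open>auto simp: comp_def\<close>)
qed

text \<open>Path keys receive the fresh largest time, so they may sit above the hanging subtrees.
  Inside these, \<rho> and the sets of touching queries are unchanged, so all waiting times drop by
  one together. Among path keys \<rho> ties, and there \<tau> equals \<open>wait\<close>.\<close>

lemma gf_step_heap:
  assumes bst: "bst T" and heap: "heap_wrt (prior (set_tree T) \<rho> (x # fut)) T"
    and bd: "\<And>z. z \<in> set_tree T \<Longrightarrow> \<rho> z \<le> t"
  shows "heap_wrt (prior (set_tree T) (touch (set_tree T) (Suc t) \<rho> x) fut) (gf_step T x fut)"
proof -
  let ?K = "set_tree T"
  let ?\<rho> = "touch ?K (Suc t) \<rho> x"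
  let ?le = "prior ?K ?\<rho> fut"
  obtain vs Rs where f: "frame 0 T x = (vs, Rs)" by fastforce
  define k where "k = length vs"
  define lo where "lo = (\<lambda>i. if i = 0 then None else Some (fst (vs ! (i - 1))))"
  define hi where "hi = (\<lambda>i. if Suc i < k then Some (fst (vs ! Suc i)) else None)"
  define pr where "pr = map (\<lambda>i. (fst (vs ! i), (first_in (in_open (lo i) (hi i)) fut, snd (vs ! i)))) [0..<k]"
  have vs: "map fst vs = path T x" using map_fst_frame[of 0 T x] f by simp
  have Rs: "length Rs = Suc (length (map fst vs))" "weave (map fst vs) Rs = inorder T"
    using length_snd_frame[of 0 T x] weave_frame[of T x 0] f vs[symmetric] by simp_all
  have tch: "fst ` set vs = {y. touched ?K \<rho> x y}"
    using set_path_eq_touched[OF bst heap] vs[symmetric] by simp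
  have srt: "sorted_wrt (<) (inorder T)" using bst by (simp add: bst_iff_sorted_wrt_less)
  have svs: "sorted_wrt (<) (map fst vs)"
    using sorted_weave[of "map fst vs" Rs] srt Rs by simp
  have inR: "z \<in> ?K \<and> \<not> touched ?K \<rho> x z" if "R \<in> set Rs" "z \<in> set_tree R" for R z
  proof -
    have "distinct (inorder T)" using srt by (simp add: strict_sorted_iff)
    then have "z \<notin> fst ` set vs"
      using distinct_weave_disjoint[of "map fst vs" Rs R] Rs that by auto
    moreover have "z \<in> ?K" using set_weave[OF Rs(1)] Rs(2) that by auto
    ultimately show ?thesis using tch by auto
  qed
  have rho_vs: "?\<rho> v = Suc t" if "v \<in> fst ` set vs" for v
    using that tch by (simp add: touch_def)
  have rho_not: "?\<rho> z \<le> t" if "z \<in> ?K" "z \<notin> fst ` set vs" for z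
    using that tch bd by (simp add: touch_def)
  \<comment> \<open>Exactly the path keys carry the maximal time \<open>Suc t\<close>. So a query
    \<open>q\<close> touches \<open>v_i\<close> iff no path key lies on the way from
    \<open>q\<close> to \<open>v_i\<close>, which means that \<open>q\<close> is strictly between
    the two neighbours of \<open>v_i\<close> on the path.\<close>
  have open_eq: "in_open (lo i) (hi i) q \<longleftrightarrow> touched ?K ?\<rho> q (fst (vs ! i))" if i: "i < k" for i q
  proof -
    let ?v = "fst (vs ! i)"
    have mono: "fst (vs ! j) < fst (vs ! j')" if "j < j'" "j' < k" for j j'
      using sorted_wrt_nth_less[OF svs, of j j'] that by (simp add: k_def)
    have mem: "fst (vs ! j) \<in> fst ` set vs" if "j < k" for j
      using that by (simp add: k_def)
    have K: "fst ` set vs \<subseteq> ?K" using tch by (auto simp: touched_def)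
    show ?thesis
    proof
      assume o: "in_open (lo i) (hi i) q"
      have "?\<rho> z < ?\<rho> ?v" if z: "z \<in> ?K" "between q ?v z" for z
      proof -
        have "z \<notin> fst ` set vs"
        proof
          assume "z \<in> fst ` set vs"
          then obtain j where j: "j < k" "z = fst (vs ! j)"
            by (auto simp: in_set_conv_nth k_def)
          consider "j < i" | "j = i" | "i < j" by linarith
          then show False
          proof cases
            case 1
            then have "j = i - 1 \<or> j < i - 1" by linarith
            then have "z \<le> fst (vs ! (i - 1))"
            proof
              assume "j < i - 1"
              moreover have "i - 1 < k" using i by simp
              ultimately show ?thesis using mono j(2) less_imp_le by blast
            qed (simp add: j(2))
            moreover have "fst (vs ! (i - 1)) < q" using o 1 by (simp add: in_open_def lo_def)
            moreover have "z < ?v" using mono[OF 1 i] j(2) by simp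
            ultimately show False using z(2) by (auto simp: between_def)
          next
            case 2
            then show False using z(2) j by (simp add: between_def)
          next
            case 3
            then have "j = Suc i \<or> Suc i < j" by linarith
            then have "fst (vs ! Suc i) \<le> z"
            proof
              assume "Suc i < j"
              then show ?thesis using mono j less_imp_le by blast
            qed (simp add: j(2))
            moreover have "q < fst (vs ! Suc i)" using o 3 j(1) by (simp add: in_open_def hi_def)
            moreover have "?v < z" using mono[OF 3 j(1)] j(2) by simp
            ultimately show False using z(2) by (auto simp: between_def)
          qed
        qed
        then show ?thesis using rho_not[OF z(1)] rho_vs[OF mem[OF i]] by simp
      qed
      then show "touched ?K ?\<rho> q ?v" using K mem[OF i] by (auto simp: touched_def)
    next
      assume tq: "touched ?K ?\<rho> q ?v"
      have nb: "\<not> between q ?v (fst (vs ! j))" if "j < k" for j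
      proof
        assume "between q ?v (fst (vs ! j))"
        moreover have "fst (vs ! j) \<in> ?K" using mem[OF that] K by blast
        ultimately have "?\<rho> (fst (vs ! j)) < ?\<rho> ?v" using tq unfolding touched_def[of _ ?\<rho>] by blast
        then show False using rho_vs[OF mem[OF that]] rho_vs[OF mem[OF i]] by simp
      qed
      have "fst (vs ! (i - 1)) < q" if "i \<noteq> 0"
      proof -
        have "fst (vs ! (i - 1)) < ?v" by (rule mono) (use that i in auto)
        moreover have "i - 1 < k" using i by simp
        ultimately show ?thesis using nb[of "i - 1"] unfolding between_def by (metis not_le)
      qed
      moreover have "q < fst (vs ! Suc i)" if "Suc i < k"
        using nb[OF that] mono[OF lessI that] unfolding between_def by (metis not_le)
      ultimately show "in_open (lo i) (hi i) q"
        by (auto simp: in_open_def lo_def hi_def)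
    qed
  qed
  have wait_eq: "first_in (in_open (lo i) (hi i)) fut = wait ?K ?\<rho> fut (fst (vs ! i))" if "i < k" for i
    unfolding wait_def by (rule arg_cong[of _ _ "\<lambda>P. first_in P fut"]) (simp add: fun_eq_iff open_eq[OF that])
  have pr_wait: "\<exists>i<k. v = fst (vs ! i) \<and> fst p = wait ?K ?\<rho> fut v" if vp: "(v, p) \<in> set pr" for v p
  proof -
    obtain i where i: "i < k" and v: "v = fst (vs ! i)"
      and p: "p = (first_in (in_open (lo i) (hi i)) fut, snd (vs ! i))"
      using vp unfolding pr_def by auto
    show ?thesis unfolding v p fst_conv wait_eq[OF i] using i by blast
  qed
  have "heap_wrt ?le (build k pr Rs)"
  proof (rule heap_build)
    show "length pr \<le> k" "length Rs = Suc (length pr)" using Rs by (auto simp: pr_def k_def)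
    show "heap_wrt ?le R" if R: "R \<in> set Rs" for R
    proof (rule heap_mono)
      show "heap_wrt (prior ?K \<rho> (x # fut)) R"
        using heap_frame[OF heap, of R 0 x] f R by simp
      fix a z assume az: "a \<in> set_tree R" "z \<in> set_tree R" "prior ?K \<rho> (x # fut) a z"
      \<comment> \<open>The query \<open>x\<close> misses \<open>y\<close>, so \<open>x\<close>
        contributes the one \<open>eSuc\<close>; the later queries touching \<open>y\<close> are the
        same under both valuations.\<close>
      have *: "?\<rho> y = \<rho> y" "wait ?K \<rho> (x # fut) y = eSuc (wait ?K ?\<rho> fut y)"
        if "y \<in> set_tree R" for y
        using inR[OF R that] touched_touch_iff[of ?K \<rho> t y x] bd
        by (simp_all add: touch_def wait_def)
      show "?le a z"
        using az by (simp add: prior_def *)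
    qed
    show "?le v z" if "v \<in> fst ` set pr" "R \<in> set Rs" "z \<in> set_tree R" for v R z
    proof -
      have "v \<in> fst ` set vs" using that(1) by (auto simp: pr_def k_def)
      moreover have "z \<notin> fst ` set vs" "z \<in> ?K" using inR[OF that(2,3)] tch by auto
      ultimately show ?thesis using rho_vs[of v] rho_not[of z] by (simp add: prior_def)
    qed
    show "?le v w" if vp: "(v, p) \<in> set pr" and wq: "(w, q) \<in> set pr" and "p \<le> q" for v w p q
    proof -
      obtain i where i: "i < k" "v = fst (vs ! i)" "fst p = wait ?K ?\<rho> fut v"
        using pr_wait[OF vp] by blast
      obtain j where j: "j < k" "w = fst (vs ! j)" "fst q = wait ?K ?\<rho> fut w"
        using pr_wait[OF wq] by blast
      \<comment> \<open>Only the first component of the lexicographic priority matters; the depth is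
        dropped.\<close>
      have "fst p \<le> fst q" using that(3) by (auto simp: less_eq_prod_def)
      moreover have "?\<rho> v = Suc t" "?\<rho> w = Suc t"
        by (rule rho_vs, use i j in \<open>simp add: k_def\<close>)+
      ultimately show ?thesis using i(3) j(3) by (simp add: prior_def)
    qed
  qed
  then show ?thesis
    by (simp add: gf_step_def f Let_def k_def lo_def hi_def pr_def)
qed

section \<open>Serving a whole sequence\<close>

lemma gf_serve_heap:
  assumes "bst T" "set_tree T = K" "heap_wrt (prior K \<rho> (S @ Y)) T" "\<And>z. z \<in> K \<Longrightarrow> \<rho> z \<le> t"
  shows "bst (gf_serve T (S @ Y) (length S)) \<and> set_tree (gf_serve T (S @ Y) (length S)) = K \<and>
    heap_wrt (prior K (run K t \<rho> S) Y) (gf_serve T (S @ Y) (length S))"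
  using assms
proof (induction S arbitrary: T \<rho> t)
  case (Cons x S)
  have io: "inorder (gf_step T x (S @ Y)) = inorder T" by (rule gf_step_inorder)
  have "bst (gf_step T x (S @ Y))"
    using Cons.prems(1) io by (simp add: bst_iff_sorted_wrt_less)
  moreover have "set_tree (gf_step T x (S @ Y)) = K"
    using io Cons.prems(2) by (metis set_inorder)
  moreover have "heap_wrt (prior K (touch K (Suc t) \<rho> x) (S @ Y)) (gf_step T x (S @ Y))"
    using gf_step_heap[of T \<rho> x "S @ Y" t] Cons.prems by simp
  moreover have "touch K (Suc t) \<rho> x z \<le> Suc t" if "z \<in> K" for z
    using Cons.prems(4)[OF that] by (simp add: touch_def)
  ultimately show ?case
    using Cons.IH[of "gf_step T x (S @ Y)" "touch K (Suc t) \<rho> x" "Suc t"] by simp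
qed simp

text \<open>Reduces the claim to last touch times: it remains to find \<open>S\<close> that makes
  \<rho> strictly heap-ordered on \<open>T\<close> from every past. The tree actually held is weakly
  heap-ordered by \<rho> whatever \<open>Y\<close> is, so uniqueness applies.\<close>

lemma gf_serve_eq:
  fixes T :: "'a::linorder tree"
  assumes T: "bst T"
    and S: "\<And>\<rho> t. (\<And>z. z \<in> set_tree T \<Longrightarrow> \<rho> z \<le> t) \<Longrightarrow>
              heap_wrt (\<lambda>a z. run (set_tree T) t \<rho> S z < run (set_tree T) t \<rho> S a) T"
    and T0: "bst T0" "set_tree T0 = set_tree T"
  shows "gf_serve T0 (S @ Y) (length S) = T"
proof -
  obtain \<rho> :: "'a \<Rightarrow> nat" where \<rho>: "heap_wrt (\<lambda>a z. \<rho> z < \<rho> a) T0"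
    using ex_strict_heap[OF T0(1)] by blast
  define t where "t = Max (\<rho> ` set_tree T)"
  have t: "\<rho> z \<le> t" if "z \<in> set_tree T" for z
    using that by (simp add: t_def)
  have "heap_wrt (prior (set_tree T) \<rho> (S @ Y)) T0"
    by (rule heap_mono[OF \<rho>]) (simp add: prior_def)
  from gf_serve_heap[OF T0 this t] have
    *: "bst (gf_serve T0 (S @ Y) (length S))" "set_tree (gf_serve T0 (S @ Y) (length S)) = set_tree T"
      "heap_wrt (prior (set_tree T) (run (set_tree T) t \<rho> S) Y) (gf_serve T0 (S @ Y) (length S))"
    by auto
  show ?thesis
  proof (rule heap_bst_unique[OF T *(1,2) heap_mono[OF *(3)] S[OF t]])
    fix a z assume "prior (set_tree T) (run (set_tree T) t \<rho> S) Y a z"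
    then show "run (set_tree T) t \<rho> S z \<le> run (set_tree T) t \<rho> S a"
      by (auto simp: prior_def)
  qed
qed

section \<open>Shielded keys\<close>

text \<open>Every key outside \<open>U\<close> is shielded from all queries in \<open>U\<close> by a key of \<open>U\<close>. Queries in \<open>U\<close> only
increase \<open>\<rho>\<close> on \<open>U\<close>, so this persists, and the keys outside \<open>U\<close> may be forgotten.\<close>

definition shut :: "'a::linorder set \<Rightarrow> 'a set \<Rightarrow> ('a \<Rightarrow> nat) \<Rightarrow> bool" where
  "shut K U \<rho> \<longleftrightarrow> U \<subseteq> K \<and> (\<forall>z\<in>K - U. \<forall>u\<in>U. \<exists>w\<in>U. between u z w \<and> \<rho> z \<le> \<rho> w)"

lemma run_append: "run K t \<rho> (xs @ ys) = run K (t + length xs) (run K t \<rho> xs) ys"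
  by (induction xs arbitrary: t \<rho>) auto

lemma run_notin: "y \<notin> K \<Longrightarrow> run K t \<rho> xs y = \<rho> y"
  by (induction xs arbitrary: t \<rho>) (auto simp: touch_def touched_def)

lemma run_le: "\<forall>y\<in>K. \<rho> y \<le> t \<Longrightarrow> \<forall>y\<in>K. run K t \<rho> xs y \<le> t + length xs"
proof (induction xs arbitrary: t \<rho>)
  case (Cons x xs)
  have "\<forall>y\<in>K. touch K (Suc t) \<rho> x y \<le> Suc t"
    using Cons.prems by (auto simp: touch_def le_Suc_eq)
  from Cons.IH[OF this] show ?case by simp
qed simp

text \<open>If a key \<open>z\<close> outside \<open>U\<close> blocks \<open>y\<close>, its shield
  \<open>w\<close> lies between \<open>x\<close> and \<open>z\<close>, is at least as recent, and
  blocks \<open>y\<close> as well. A key outside \<open>U\<close> is blocked by its own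
  shield.\<close>

lemma touch_shut:
  assumes "shut K U \<rho>" "x \<in> U"
  shows "touch K t \<rho> x = touch U t \<rho> x"
proof -
  have "touched K \<rho> x y \<longleftrightarrow> touched U \<rho> x y" for y
  proof (cases "y \<in> U")
    case True
    have "\<rho> z < \<rho> y" if t: "touched U \<rho> x y" and z: "z \<in> K" "between x y z" for z
    proof (cases "z \<in> U")
      case False
      then obtain w where w: "w \<in> U" "between x z w" "\<rho> z \<le> \<rho> w"
        using assms z unfolding shut_def by blast
      then have "between x y w" using z by (auto simp: between_def)
      then show ?thesis using t w by (auto simp: touched_def)
    qed (use t z in \<open>auto simp: touched_def\<close>)
    then show ?thesis using True assms(1) by (auto simp: touched_def shut_def)
  next
    case False
    then have "\<not> touched K \<rho> x y"
      using assms by (fastforce simp: touched_def shut_def)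
    then show ?thesis using False by (simp add: touched_def)
  qed
  then show ?thesis by (simp add: touch_def)
qed

lemma shut_touch:
  assumes "shut K U \<rho>" "\<forall>y\<in>U. \<rho> y \<le> t"
  shows "shut K U (touch U t \<rho> x)"
  unfolding shut_def
proof (intro conjI ballI)
  show "U \<subseteq> K" using assms(1) by (simp add: shut_def)
  fix z u assume zu: "z \<in> K - U" "u \<in> U"
  then obtain w where w: "w \<in> U" "between u z w" "\<rho> z \<le> \<rho> w"
    using assms(1) unfolding shut_def by blast
  moreover have "touch U t \<rho> x z = \<rho> z" "\<rho> w \<le> touch U t \<rho> x w"
    using zu w(1) assms(2) by (auto simp: touch_def touched_def)
  ultimately show "\<exists>w\<in>U. between u z w \<and> touch U t \<rho> x z \<le> touch U t \<rho> x w" by fastforce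
qed

lemma run_shut:
  assumes "shut K U \<rho>" "set xs \<subseteq> U" "\<forall>y\<in>U. \<rho> y \<le> t"
  shows "run K t \<rho> xs = run U t \<rho> xs"
  using assms
proof (induction xs arbitrary: t \<rho>)
  case (Cons x xs)
  have "\<forall>y\<in>U. touch U (Suc t) \<rho> x y \<le> Suc t"
    using Cons.prems(3) by (auto simp: touch_def le_Suc_eq)
  then show ?case
    using Cons shut_touch[of K U \<rho> "Suc t" x] by (simp add: touch_shut[of K U] le_Suc_eq)
qed simp

section \<open>The sweep from right to left\<close>

definition sweep :: "'a list \<Rightarrow> 'a list" where
  "sweep us = concat (map (\<lambda>x. [x, x]) (rev us))"

text \<open>After the first query \<open>x\<close> ties for the maximum, hence blocks every other
  key from a second query at \<open>x\<close>. That query therefore makes \<open>x\<close> the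
  strict maximum.\<close>

lemma touch_twice:
  assumes "x \<in> K" "\<forall>y\<in>K. \<rho> y \<le> t"
  shows "touch K (Suc (Suc t)) (touch K (Suc t) \<rho> x) x = (touch K (Suc t) \<rho> x)(x := Suc (Suc t))"
proof -
  have x: "touched K \<rho> x x" using assms(1) by (auto simp: touched_def between_def)
  have "touched K (touch K (Suc t) \<rho> x) x y \<longleftrightarrow> y = x" for y
  proof
    assume y: "touched K (touch K (Suc t) \<rho> x) x y"
    show "y = x"
    proof (rule ccontr)
      assume "y \<noteq> x"
      then have "between x y x" by (auto simp: between_def)
      then have "touch K (Suc t) \<rho> x x < touch K (Suc t) \<rho> x y"
        using y assms(1) unfolding touched_def[of K "touch K (Suc t) \<rho> x"] by blast
      then have "Suc t < touch K (Suc t) \<rho> x y" using x by (simp add: touch_def)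
      then show False
        using y assms(2) by (auto simp: touch_def touched_def split: if_splits)
    qed
  qed (use assms(1) in \<open>auto simp: touched_def between_def\<close>)
  then show ?thesis by (auto simp: touch_def)
qed

text \<open>The last conjunct drives the induction: the previous key \<open>j\<close> is the strict
  maximum of \<open>K\<close>, so the next query \<open>i < j\<close> touches \<open>j\<close> but
  nothing beyond it. Then \<open>j\<close> has time \<open>Suc s\<close>, \<open>i\<close> has
  \<open>Suc (Suc s)\<close>, and everything right of \<open>j\<close> keeps its smaller
  value.\<close>

lemma sweep_shut:
  assumes "us \<noteq> []" "sorted_wrt (<) us" "set us \<subseteq> K" "\<forall>y\<in>K. \<rho> y \<le> t"
  defines "\<rho>' \<equiv> run K t \<rho> (sweep us)"
  shows "shut K (set us) \<rho>' \<and> (\<forall>x\<in>set us. \<forall>y\<in>set us. x < y \<longrightarrow> \<rho>' y < \<rho>' x) \<and>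
    (\<forall>y\<in>K. y \<noteq> hd us \<longrightarrow> \<rho>' y < \<rho>' (hd us))"
  using assms(1-4) unfolding \<rho>'_def
proof (induction us rule: list_nonempty_induct)
  case (single i)
  have *: "run K t \<rho> (sweep [i]) = (touch K (Suc t) \<rho> i)(i := Suc (Suc t))"
    using single touch_twice[of i K \<rho> t] by (simp add: sweep_def)
  have lt: "y \<noteq> i \<longrightarrow> run K t \<rho> (sweep [i]) y < run K t \<rho> (sweep [i]) i" if "y \<in> K" for y
    unfolding * using single that by (auto simp: touch_def less_Suc_eq_le le_Suc_eq)
  then have "shut K {i} (run K t \<rho> (sweep [i]))"
    using single unfolding shut_def by (fastforce simp: between_def)
  then show ?case using lt by simp
next
  case (cons i us)
  define \<sigma> where "\<sigma> = run K t \<rho> (sweep us)"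
  define s where "s = t + length (sweep us)"
  define j where "j = hd us"
  have j: "j \<in> set us" "i < j" "\<And>x. x \<in> set us \<Longrightarrow> j \<le> x"
    using cons.hyps cons.prems(1) by (cases us; auto simp: j_def)+
  have IH: "shut K (set us) \<sigma>" "\<And>x y. x \<in> set us \<Longrightarrow> y \<in> set us \<Longrightarrow> x < y \<Longrightarrow> \<sigma> y < \<sigma> x"
    "\<And>y. y \<in> K \<Longrightarrow> y \<noteq> j \<Longrightarrow> \<sigma> y < \<sigma> j"
    using cons.IH cons.prems by (auto simp: \<sigma>_def j_def)
  have le: "\<forall>y\<in>K. \<sigma> y \<le> s"
    using run_le[of K \<rho> t "sweep us"] cons.prems by (simp add: \<sigma>_def s_def)
  have K: "i \<in> K" "set us \<subseteq> K" using cons.prems by auto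
  define \<tau> where "\<tau> = (touch K (Suc s) \<sigma> i)(i := Suc (Suc s))"
  have \<tau>: "run K t \<rho> (sweep (i # us)) = \<tau>"
    using touch_twice[OF K(1) le]
    by (simp add: sweep_def run_append \<tau>_def \<sigma>_def[unfolded sweep_def] s_def[unfolded sweep_def])
  have tj: "touched K \<sigma> i j"
    using IH(3) j K by (auto simp: touched_def between_def)
  have beyond: "\<tau> y = \<sigma> y" if "j < y" for y
  proof -
    have "between i y j" using that j by (auto simp: between_def)
    then have "\<not> touched K \<sigma> i y"
      using IH(3)[of y] that j(1) K(2) by (fastforce simp: touched_def)
    moreover have "y \<noteq> i" using that j(2) by auto
    ultimately show ?thesis by (simp add: \<tau>_def touch_def)
  qed
  have \<tau>j: "\<tau> j = Suc s" using tj j by (simp add: \<tau>_def touch_def)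
  have \<tau>i: "\<tau> i = Suc (Suc s)" by (simp add: \<tau>_def)
  have \<tau>le: "\<tau> y \<le> Suc s" if "y \<in> K" "y \<noteq> i" for y
    using le that by (auto simp: \<tau>_def touch_def le_Suc_eq)
  have max: "\<forall>y\<in>K. y \<noteq> i \<longrightarrow> \<tau> y < \<tau> i" using \<tau>le \<tau>i by fastforce
  have dec: "\<tau> y < \<tau> x" if "x \<in> set (i # us)" "y \<in> set (i # us)" "x < y" for x y
  proof (cases "x = i")
    case True
    then show ?thesis using max that K(2) by auto
  next
    case False
    then have x: "x \<in> set us" using that by simp
    then have "y \<noteq> i" using that(3) j(2) j(3)[OF x] by auto
    then have y: "y \<in> set us" using that by simp
    show ?thesis
    proof (cases "x = j")
      case True
      then have "\<tau> y \<le> s" using beyond[of y] that le K(2) y by auto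
      then show ?thesis using True \<tau>j by simp
    next
      case False
      then have "j < x" using j(3)[OF x] by simp
      then show ?thesis using beyond[of x] beyond[of y] that IH(2)[OF x y] by simp
    qed
  qed
  have "\<exists>w\<in>set (i # us). between u z w \<and> \<tau> z \<le> \<tau> w"
    if z: "z \<in> K - set (i # us)" and u: "u \<in> set (i # us)" for z u
  proof -
    \<comment> \<open>Keys left of \<open>i\<close> are shielded by \<open>i\<close>, and keys
      between \<open>i\<close> and \<open>j\<close> by whichever of the two is on the side of the
      query.\<close>
    have zi: "\<tau> z \<le> \<tau> i" "\<tau> z \<le> \<tau> j" using \<tau>le[of z] \<tau>i \<tau>j z by auto
    consider "z < i" | "i < z" "z < j" | "j < z"
      using z j(1) by (metis DiffE linorder_neqE list.set_intros)
    then show ?thesis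
    proof cases
      case 1
      then have "between u z i" using u j by (auto simp: between_def intro: less_imp_le order_trans)
      then show ?thesis using zi by auto
    next
      case 2
      then have "u = i \<and> between u z i \<or> between u z j"
        using u j by (auto simp: between_def)
      then show ?thesis using zi j(1) by auto
    next
      case 3
      \<comment> \<open>A query at \<open>i\<close> must pass \<open>j\<close> to reach
        \<open>z\<close>, so the old shield of \<open>z\<close> against \<open>j\<close> also works
        against \<open>i\<close>.\<close>
      define u' where "u' = (if u = i then j else u)"
      have "u' \<in> set us" using u j by (auto simp: u'_def)
      moreover have "z \<in> K - set us" using z by simp
      ultimately obtain w where w: "w \<in> set us" "between u' z w" "\<sigma> z \<le> \<sigma> w"
        using IH(1) unfolding shut_def by blast
      have "between u z w" using w(2) 3 j(2) by (auto simp: between_def u'_def split: if_splits)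
      moreover have "\<tau> z \<le> \<tau> w"
      proof (cases "w = j")
        case False
        then have "j < w" using j(3)[OF w(1)] by simp
        then show ?thesis using beyond[of w] beyond[OF 3] w(3) by simp
      qed (use zi in simp)
      ultimately show ?thesis using w(1) by auto
    qed
  qed
  then have "shut K (set (i # us)) \<tau>"
    using K by (auto simp: shut_def)
  then show ?case using dec max \<tau> by auto
qed

section \<open>Removing the non-leaves\<close>

text \<open>A leaf in the sense of the argument is a node with two empty subtrees, not the
  constructor \<open>Leaf\<close>. The list is in key order, as \<open>sweep\<close>
  expects.\<close>

fun inner :: "'a tree \<Rightarrow> 'a list" where
  "inner Leaf = []"
| "inner (Node l a r) = (if l = Leaf \<and> r = Leaf then [] else inner l @ a # inner r)"

abbreviation big :: "'a tree \<Rightarrow> bool" where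
  "big t \<equiv> 2 \<le> size t"

text \<open>Removes the inner nodes of the subtree in postorder; \<open>lo\<close> and \<open>hi\<close> are its neighbours among the keys
not yet removed. A node can be removed once it and both neighbours have been touched by the same query.
A missing neighbour is replaced by the node itself.\<close>

fun plan :: "'a option \<Rightarrow> 'a option \<Rightarrow> 'a tree \<Rightarrow> 'a list" where
  "plan lo hi Leaf = []"
| "plan lo hi (Node l p r) =
     (let L = (case lo of None \<Rightarrow> p | Some a \<Rightarrow> a); H = (case hi of None \<Rightarrow> p | Some b \<Rightarrow> b) in
      if \<not> big l \<and> \<not> big r then [H]
      else (if big l then plan lo (Some p) l else [p]) @
           (if big r then plan (Some p) hi r @ [H, L] else [L, H]))"

lemma inner_not_big: "\<not> big t \<Longrightarrow> inner t = []"
  by (cases t) (auto simp: not_le less_Suc_eq numeral_2_eq_2 eq_size_0)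

lemma inner_big: "big (Node l a r) \<Longrightarrow> inner (Node l a r) = inner l @ a # inner r"
  by auto

lemma set_inner_subset: "set (inner t) \<subseteq> set_tree t"
  by (induction t) auto

section \<open>Keys touched by queries next to a node\<close>

lemma touched_peak:
  assumes "q \<in> U" "\<forall>y\<in>U. \<rho> y \<le> \<rho> q"
  shows "touched U \<rho> q y \<longleftrightarrow> y \<in> {q}"
proof
  assume y: "touched U \<rho> q y"
  show "y \<in> {q}"
  proof (rule ccontr)
    assume "y \<notin> {q}"
    then have "between q y q" by (auto simp: between_def)
    then have "\<rho> q < \<rho> y" using y assms(1) by (auto simp: touched_def)
    then show False using y assms(2) by (auto simp: touched_def)
  qed
qed (use assms(1) in \<open>auto simp: touched_def between_def\<close>)

text \<open>\<open>A\<close> holds the remaining keys left of a subtree. As \<open>lo\<close> is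
  both its rightmost and a most recent key, a query from the right of \<open>A\<close> can touch no
  other key of \<open>A\<close>. \<open>None\<close> stands for empty \<open>A\<close>.\<close>

definition upper_end :: "('a::linorder \<Rightarrow> nat) \<Rightarrow> 'a set \<Rightarrow> 'a option \<Rightarrow> bool" where
  "upper_end \<rho> A lo \<longleftrightarrow>
     (case lo of None \<Rightarrow> A = {} | Some a \<Rightarrow> a \<in> A \<and> (\<forall>y\<in>A. y \<le> a \<and> \<rho> y \<le> \<rho> a))"

definition lower_end :: "('a::linorder \<Rightarrow> nat) \<Rightarrow> 'a set \<Rightarrow> 'a option \<Rightarrow> bool" where
  "lower_end \<rho> B hi \<longleftrightarrow>
     (case hi of None \<Rightarrow> B = {} | Some b \<Rightarrow> b \<in> B \<and> (\<forall>y\<in>B. b \<le> y \<and> \<rho> y \<le> \<rho> b))"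

text \<open>Walking left from \<open>q\<close>, the records are \<open>q\<close>, then
  \<open>p\<close>, then \<open>lo\<close>, which blocks the rest of \<open>A\<close>. To the right,
  \<open>q\<close> blocks all other keys of \<open>B\<close>.\<close>

lemma touched_left:
  assumes "\<forall>a\<in>A. a < p" "\<forall>b\<in>B. p < b"
    and lo: "upper_end \<rho> A lo" "\<forall>a\<in>set_option lo. \<rho> p < \<rho> a"
    and q: "q = p \<or> q \<in> B \<and> (\<forall>y\<in>B. q \<le> y) \<and> \<rho> q < \<rho> p" "\<forall>y\<in>B. \<rho> y \<le> \<rho> q"
  shows "touched (A \<union> {p} \<union> B) \<rho> q y \<longleftrightarrow> y \<in> {q, p} \<union> set_option lo"
proof -
  have pq: "p \<le> q" using q(1) assms(2) by auto
  consider "y \<in> A" | "y = p" | "y \<in> B" | "y \<notin> A \<union> {p} \<union> B" by blast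
  then show ?thesis
  proof cases
    case 1
    then obtain a where a: "lo = Some a" "a \<in> A" "\<forall>y\<in>A. y \<le> a \<and> \<rho> y \<le> \<rho> a"
      using lo(1) by (auto simp: upper_end_def split: option.splits)
    have y: "y < p" "y \<noteq> p" "y \<noteq> q" using 1 assms(1) pq by auto
    show ?thesis
    proof (cases "y = a")
      case True
      have "\<rho> z < \<rho> a" if z: "z \<in> A \<union> {p} \<union> B" "between q a z" for z
      proof -
        have "z \<notin> A" using z(2) a pq y True by (auto simp: between_def dest: leD)
        moreover have "z \<in> B \<Longrightarrow> \<rho> z < \<rho> p \<or> q = p \<and> p < z"
          using q assms(2) by (auto dest: order_le_less_trans)
        ultimately show ?thesis using z lo(2) a(1) q y True assms(2)
          by (auto simp: between_def)
      qed
      then show ?thesis using True a by (auto simp: touched_def)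
    next
      case False
      then have "y < a" using a(3) 1 by (simp add: order.strict_iff_order)
      moreover have "a < p" using a(2) assms(1) by blast
      ultimately have "between q y a" using pq by (auto simp: between_def)
      moreover have "\<rho> y \<le> \<rho> a" using a 1 by blast
      ultimately have "\<not> touched (A \<union> {p} \<union> B) \<rho> q y" using a(2) unfolding touched_def by (meson UnCI leD)
      then show ?thesis using False y a by auto
    qed
  next
    case 2
    have "\<rho> z < \<rho> p" if z: "z \<in> A \<union> {p} \<union> B" "between q p z" for z
    proof -
      have "p < z" "z \<le> q" using z(2) pq by (auto simp: between_def)
      then show ?thesis using z(1) q assms(1,2) by (auto dest: less_asym)
    qed
    then show ?thesis using 2 by (auto simp: touched_def)
  next
    case 3
    show ?thesis
    proof (cases "y = q")
      case True
      then show ?thesis using 3 by (auto simp: touched_def between_def)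
    next
      case False
      then have "between q y q" using 3 q(1) assms(2) by (auto simp: between_def)
      moreover have "\<rho> y \<le> \<rho> q" using q(2) 3 by blast
      moreover have "q \<in> A \<union> {p} \<union> B" using q(1) by blast
      ultimately have "\<not> touched (A \<union> {p} \<union> B) \<rho> q y" unfolding touched_def by (meson leD)
      moreover have "p < y" using 3 assms(2) by blast
      moreover have "y \<notin> set_option lo"
        using lo(1) assms(1) \<open>p < y\<close> by (auto simp: upper_end_def split: option.splits)
      ultimately show ?thesis using False by auto
    qed
  next
    case 4
    then show ?thesis using q(1) lo(1) by (auto simp: touched_def upper_end_def split: option.splits)
  qed
qed

text \<open>The mirror image of \<open>touched_left\<close>, with the query at \<open>p\<close> or
  at its left neighbour.\<close>

lemma touched_right:
  assumes "\<forall>a\<in>A. a < p" "\<forall>b\<in>B. p < b"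
    and hi: "lower_end \<rho> B hi" "\<forall>b\<in>set_option hi. \<rho> p < \<rho> b"
    and q: "q = p \<or> q \<in> A \<and> (\<forall>y\<in>A. y \<le> q) \<and> \<rho> q < \<rho> p" "\<forall>y\<in>A. \<rho> y \<le> \<rho> q"
  shows "touched (A \<union> {p} \<union> B) \<rho> q y \<longleftrightarrow> y \<in> {q, p} \<union> set_option hi"
proof -
  have pq: "q \<le> p" using q(1) assms(1) by auto
  consider "y \<in> B" | "y = p" | "y \<in> A" | "y \<notin> A \<union> {p} \<union> B" by blast
  then show ?thesis
  proof cases
    case 1
    then obtain b where b: "hi = Some b" "b \<in> B" "\<forall>y\<in>B. b \<le> y \<and> \<rho> y \<le> \<rho> b"
      using hi(1) by (auto simp: lower_end_def split: option.splits)
    have y: "p < y" "y \<noteq> p" "y \<noteq> q" using 1 assms(2) pq by auto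
    show ?thesis
    proof (cases "y = b")
      case True
      have "\<rho> z < \<rho> b" if z: "z \<in> A \<union> {p} \<union> B" "between q b z" for z
      proof -
        have "z \<notin> B" using z(2) b pq y True by (auto simp: between_def dest: leD)
        moreover have "z \<in> A \<Longrightarrow> \<rho> z < \<rho> p \<or> q = p \<and> z < p"
          using q assms(1) by (auto dest: order_le_less_trans)
        ultimately show ?thesis using z hi(2) b(1) q y True assms(1)
          by (auto simp: between_def)
      qed
      then show ?thesis using True b by (auto simp: touched_def)
    next
      case False
      then have "b < y" using b(3) 1 by (simp add: order.strict_iff_order)
      moreover have "p < b" using b(2) assms(2) by blast
      ultimately have "between q y b" using pq by (auto simp: between_def)
      moreover have "\<rho> y \<le> \<rho> b" using b 1 by blast
      ultimately have "\<not> touched (A \<union> {p} \<union> B) \<rho> q y" using b(2) unfolding touched_def by (meson UnCI leD)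
      then show ?thesis using False y b by auto
    qed
  next
    case 2
    have "\<rho> z < \<rho> p" if z: "z \<in> A \<union> {p} \<union> B" "between q p z" for z
    proof -
      have "z < p" "q \<le> z" using z(2) pq by (auto simp: between_def)
      then show ?thesis using z(1) q assms(1,2) by (auto dest: less_asym)
    qed
    then show ?thesis using 2 by (auto simp: touched_def)
  next
    case 3
    show ?thesis
    proof (cases "y = q")
      case True
      then show ?thesis using 3 by (auto simp: touched_def between_def)
    next
      case False
      then have "between q y q" using 3 q(1) assms(1) by (auto simp: between_def)
      moreover have "\<rho> y \<le> \<rho> q" using q(2) 3 by blast
      moreover have "q \<in> A \<union> {p} \<union> B" using q(1) by blast
      ultimately have "\<not> touched (A \<union> {p} \<union> B) \<rho> q y" unfolding touched_def by (meson leD)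
      moreover have "y < p" using 3 assms(1) by blast
      moreover have "y \<notin> set_option hi"
        using hi(1) assms(2) \<open>y < p\<close> by (auto simp: lower_end_def split: option.splits)
      ultimately show ?thesis using False by auto
    qed
  next
    case 4
    then show ?thesis using q(1) hi(1) by (auto simp: touched_def lower_end_def split: option.splits)
  qed
qed

lemma heap_not_big: "\<not> big t \<Longrightarrow> heap_wrt le t"
  by (cases t) (auto simp: not_le less_Suc_eq numeral_2_eq_2 eq_size_0)

lemma upper_endD: "upper_end \<rho> A lo \<Longrightarrow> set_option lo \<subseteq> A"
  by (auto simp: upper_end_def split: option.splits)

lemma lower_endD: "lower_end \<rho> B hi \<Longrightarrow> set_option hi \<subseteq> B"
  by (auto simp: lower_end_def split: option.splits)

text \<open>Against queries from \<open>A\<close> the keys of \<open>I\<close> are shielded by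
  \<open>lo\<close>, and against those from \<open>B\<close> by \<open>hi\<close>. The ends may
  refer to other valuations \<sigma>, \<tau>: only the positions of \<open>lo\<close> and
  \<open>hi\<close> are taken from them, while recency is compared under \<rho>.\<close>

lemma shut_remove:
  assumes "\<forall>a\<in>A. \<forall>x\<in>I. a < x" "\<forall>x\<in>I. \<forall>b\<in>B. x < b"
    and "upper_end \<sigma> A lo" "lower_end \<tau> B hi"
    and le: "\<forall>x\<in>I. \<forall>y\<in>set_option lo \<union> set_option hi. \<rho> x \<le> \<rho> y"
  shows "shut (A \<union> I \<union> B) (A \<union> B) \<rho>"
  unfolding shut_def
proof (intro conjI ballI)
  fix z u assume z: "z \<in> A \<union> I \<union> B - (A \<union> B)" and u: "u \<in> A \<union> B"
  from u show "\<exists>w\<in>A \<union> B. between u z w \<and> \<rho> z \<le> \<rho> w"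
  proof
    assume "u \<in> A"
    then obtain a where "lo = Some a" "a \<in> A" "u \<le> a"
      using assms(3) by (auto simp: upper_end_def split: option.splits)
    then show ?thesis using assms(1) le z by (auto simp: between_def intro!: bexI[of _ a])
  next
    assume "u \<in> B"
    then obtain b where "hi = Some b" "b \<in> B" "b \<le> u"
      using assms(4) by (auto simp: lower_end_def split: option.splits)
    then show ?thesis using assms(2) le z by (auto simp: between_def intro!: bexI[of _ b])
  qed
qed auto

text \<open>Initially \<open>p\<close> and \<open>lo\<close> tie at the maximal time. Querying
  \<open>L\<close> touches \<open>L\<close> alone and so lifts \<open>lo\<close> strictly above
  \<open>p\<close>; the query \<open>H\<close> then touches \<open>p\<close> and both neighbours.
  With no left neighbour, \<open>L\<close> is \<open>p\<close> itself.\<close>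

lemma finish_left:
  assumes ord: "\<forall>a\<in>A. a < p" "\<forall>b\<in>B. p < b"
    and lo: "upper_end \<rho> A lo" and hi: "lower_end \<rho> B hi"
    and m: "\<rho> p = m" "\<forall>a\<in>set_option lo. \<rho> a = m" "\<forall>y\<in>A. \<rho> y \<le> m" "\<forall>y\<in>B. \<rho> y < m"
  defines "L \<equiv> case lo of None \<Rightarrow> p | Some a \<Rightarrow> a" and "H \<equiv> case hi of None \<Rightarrow> p | Some b \<Rightarrow> b"
  shows "run (A \<union> {p} \<union> B) m \<rho> [L, H] =
    (\<lambda>y. if y \<in> {p} \<union> set_option lo \<union> set_option hi then m + 2 else \<rho> y)"
proof -
  let ?U = "A \<union> {p} \<union> B"
  have L: "L \<in> insert p A" "\<rho> L = m" "L \<in> {p} \<union> set_option lo"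
    using lo m(1,2) by (auto simp: L_def upper_end_def split: option.splits)
  have "\<forall>y\<in>?U. \<rho> y \<le> \<rho> L" using m(1,3,4) L(2) by (auto intro: less_imp_le)
  then have "touched ?U \<rho> L y \<longleftrightarrow> y \<in> {L}" for y
    using touched_peak[of L ?U \<rho> y] L(1) by blast
  then have 1: "touch ?U (Suc m) \<rho> L = \<rho>(L := Suc m)"
    by (auto simp: touch_def)
  let ?\<rho> = "\<rho>(L := Suc m)"
  have LB: "L \<notin> B" using L(1) ord by (auto dest: less_asym)
  have "touched ?U ?\<rho> H y \<longleftrightarrow> y \<in> {H, p} \<union> set_option lo" for y
  proof (rule touched_left[OF ord])
    show "upper_end ?\<rho> A lo" using lo m(3) by (auto simp: upper_end_def L_def le_Suc_eq split: option.splits)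
    show "\<forall>a\<in>set_option lo. ?\<rho> p < ?\<rho> a"
      using m(1) upper_endD[OF lo] ord(1) by (auto simp: L_def split: option.splits)
    show "H = p \<or> H \<in> B \<and> (\<forall>y\<in>B. H \<le> y) \<and> ?\<rho> H < ?\<rho> p"
      using hi m(1,4) LB by (auto simp: H_def lower_end_def less_Suc_eq split: option.splits)
    show "\<forall>y\<in>B. ?\<rho> y \<le> ?\<rho> H"
      using hi LB by (auto simp: H_def lower_end_def split: option.splits)
  qed
  moreover have "{H, p} \<union> set_option lo = {p} \<union> set_option lo \<union> set_option hi"
    by (auto simp: H_def split: option.splits)
  ultimately have "touched ?U ?\<rho> H y \<longleftrightarrow> y \<in> {p} \<union> set_option lo \<union> set_option hi" for y
    by (simp only:)
  then have "touch ?U (Suc (Suc m)) ?\<rho> H =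
      (\<lambda>y. if y \<in> {p} \<union> set_option lo \<union> set_option hi then m + 2 else ?\<rho> y)"
    unfolding touch_def by (simp add: fun_eq_iff)
  then show ?thesis using 1 L(3) by auto
qed

text \<open>The mirror image of \<open>finish_left\<close>: here \<open>p\<close> and
  \<open>hi\<close> tie, so \<open>H\<close> is queried first.\<close>

lemma finish_right:
  assumes ord: "\<forall>a\<in>A. a < p" "\<forall>b\<in>B. p < b"
    and lo: "upper_end \<rho> A lo" and hi: "lower_end \<rho> B hi"
    and m: "\<rho> p = m" "\<forall>b\<in>set_option hi. \<rho> b = m" "\<forall>y\<in>B. \<rho> y \<le> m" "\<forall>y\<in>A. \<rho> y < m"
  defines "L \<equiv> case lo of None \<Rightarrow> p | Some a \<Rightarrow> a" and "H \<equiv> case hi of None \<Rightarrow> p | Some b \<Rightarrow> b"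
  shows "run (A \<union> {p} \<union> B) m \<rho> [H, L] =
    (\<lambda>y. if y \<in> {p} \<union> set_option lo \<union> set_option hi then m + 2 else \<rho> y)"
proof -
  let ?U = "A \<union> {p} \<union> B"
  have H: "H \<in> insert p B" "\<rho> H = m" "H \<in> {p} \<union> set_option hi"
    using hi m(1,2) by (auto simp: H_def lower_end_def split: option.splits)
  have "\<forall>y\<in>?U. \<rho> y \<le> \<rho> H" using m(1,3,4) H(2) by (auto intro: less_imp_le)
  then have "touched ?U \<rho> H y \<longleftrightarrow> y \<in> {H}" for y
    using touched_peak[of H ?U \<rho> y] H(1) by blast
  then have 1: "touch ?U (Suc m) \<rho> H = \<rho>(H := Suc m)"
    by (auto simp: touch_def)
  let ?\<rho> = "\<rho>(H := Suc m)"
  have HA: "H \<notin> A" using H(1) ord by (auto dest: less_asym)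
  have "touched ?U ?\<rho> L y \<longleftrightarrow> y \<in> {L, p} \<union> set_option hi" for y
  proof (rule touched_right[OF ord])
    show "lower_end ?\<rho> B hi" using hi m(3) by (auto simp: lower_end_def H_def le_Suc_eq split: option.splits)
    show "\<forall>b\<in>set_option hi. ?\<rho> p < ?\<rho> b"
      using m(1) lower_endD[OF hi] ord(2) by (auto simp: H_def split: option.splits)
    show "L = p \<or> L \<in> A \<and> (\<forall>y\<in>A. y \<le> L) \<and> ?\<rho> L < ?\<rho> p"
      using lo m(1,4) HA by (auto simp: L_def upper_end_def less_Suc_eq split: option.splits)
    show "\<forall>y\<in>A. ?\<rho> y \<le> ?\<rho> L"
      using lo HA by (auto simp: L_def upper_end_def split: option.splits)
  qed
  moreover have "{L, p} \<union> set_option hi = {p} \<union> set_option lo \<union> set_option hi"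
    by (auto simp: L_def split: option.splits)
  ultimately have "touched ?U ?\<rho> L y \<longleftrightarrow> y \<in> {p} \<union> set_option lo \<union> set_option hi" for y
    by (simp only:)
  then have "touch ?U (Suc (Suc m)) ?\<rho> L =
      (\<lambda>y. if y \<in> {p} \<union> set_option lo \<union> set_option hi then m + 2 else ?\<rho> y)"
    unfolding touch_def by (simp add: fun_eq_iff)
  then show ?thesis using 1 H(3) by auto
qed

section \<open>Induction over the removal phase\<close>

lemma plan_nonempty: "big t \<Longrightarrow> plan lo hi t \<noteq> []"
  by (cases t) (auto simp: Let_def)

lemma set_plan_subset: "big t \<Longrightarrow> set (plan lo hi t) \<subseteq> set (inner t) \<union> set_option lo \<union> set_option hi"
proof (induction t arbitrary: lo hi)
  case (Node l p r)
  have p: "inner (Node l p r) = inner l @ p # inner r" using Node.prems by (rule inner_big)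
  have LH: "(case lo of None \<Rightarrow> p | Some a \<Rightarrow> a) \<in> {p} \<union> set_option lo"
    "(case hi of None \<Rightarrow> p | Some a \<Rightarrow> a) \<in> {p} \<union> set_option hi"
    by (auto split: option.splits)
  have "set (plan lo (Some p) l) \<subseteq> set (inner l) \<union> set_option lo \<union> {p}" if "big l"
    using Node.IH(1)[OF that, of lo "Some p"] by simp
  moreover have "set (plan (Some p) hi r) \<subseteq> set (inner r) \<union> {p} \<union> set_option hi" if "big r"
    using Node.IH(2)[OF that, of "Some p" hi] by simp
  ultimately show ?case
    unfolding p using LH by (auto simp: Let_def)
qed simp

text \<open>\<open>A\<close> and \<open>B\<close> are the remaining keys on both sides. The sweep
  gives the decreasing order on the inner keys; with \<open>lo\<close> above them, each removal can
  touch a node and its left neighbour together. Both neighbours end with the final time and the rest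
  of \<open>A\<close> and \<open>B\<close> is unchanged, so the hypotheses can be re-established for
  the next subtree. Leaves are not among the keys of the run; they enter only through the bound
  \<open>m\<close>.\<close>

lemma plan_heap:
  assumes "big t" "bst t"
    and "\<forall>a\<in>A. \<forall>x\<in>set_tree t. a < x" "\<forall>x\<in>set_tree t. \<forall>b\<in>B. x < b"
    and "upper_end \<rho> A lo" "lower_end \<rho> B hi"
    and "\<forall>a\<in>set_option lo. \<forall>x\<in>set (inner t) \<union> B. \<rho> x < \<rho> a"
    and "\<forall>x\<in>set (inner t). \<forall>y\<in>set (inner t) \<union> B. x < y \<longrightarrow> \<rho> y < \<rho> x"
    and "\<forall>y\<in>A \<union> set_tree t \<union> B. \<rho> y \<le> m"
  shows "let \<rho>' = run (A \<union> set (inner t) \<union> B) m \<rho> (plan lo hi t) in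
    heap_wrt (\<lambda>a z. \<rho>' z < \<rho>' a) t \<and>
    (\<forall>y\<in>set_option lo \<union> set_option hi. \<rho>' y = m + length (plan lo hi t)) \<and>
    (\<forall>y\<in>A \<union> B - (set_option lo \<union> set_option hi). \<rho>' y = \<rho> y) \<and>
    (\<forall>y\<in>set_tree t. \<rho>' y \<le> m + length (plan lo hi t))"
  using assms
proof (induction t arbitrary: lo hi A B \<rho> m)
  case (Node l p r)
  define L where "L = (case lo of None \<Rightarrow> p | Some a \<Rightarrow> a)"
  define H where "H = (case hi of None \<Rightarrow> p | Some b \<Rightarrow> b)"
  define N where "N = set_option lo \<union> set_option hi"
  let ?Il = "set (inner l)" and ?Ir = "set (inner r)"
  note lo = Node.prems(5) and hi = Node.prems(6)
  have inn: "inner (Node l p r) = inner l @ p # inner r" using Node.prems(1) by (rule inner_big)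
  have bl: "bst l" "bst r" "\<forall>x\<in>set_tree l. x < p" "\<forall>x\<in>set_tree r. p < x"
    using Node.prems(2) by auto
  have ordp: "\<forall>a\<in>A. a < p" "\<forall>b\<in>B. p < b" using Node.prems(3,4) by auto
  have sub: "?Il \<subseteq> set_tree l" "?Ir \<subseteq> set_tree r" by (rule set_inner_subset)+
  have Ilp: "\<forall>x\<in>?Il. x < p" "\<forall>x\<in>?Ir. p < x" using sub bl by auto
  have N: "N \<subseteq> A \<union> B" using upper_endD[OF lo] lower_endD[OF hi] by (auto simp: N_def)
  have AB: "(A \<union> B) \<inter> set_tree (Node l p r) = {}"
    using Node.prems(3,4) by (auto dest: less_asym)
  have lodec: "\<forall>a\<in>set_option lo. \<forall>x\<in>?Il \<union> {p} \<union> ?Ir \<union> B. \<rho> x < \<rho> a"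
    using Node.prems(7) unfolding inn by auto
  have dec: "\<forall>x\<in>?Il \<union> {p} \<union> ?Ir. \<forall>y\<in>?Il \<union> {p} \<union> ?Ir \<union> B. x < y \<longrightarrow> \<rho> y < \<rho> x"
    using Node.prems(8) unfolding inn by auto
  have le: "\<forall>y\<in>A \<union> set_tree (Node l p r) \<union> B. \<rho> y \<le> m" by (rule Node.prems(9))
  have U: "A \<union> set (inner (Node l p r)) \<union> B = A \<union> ?Il \<union> ({p} \<union> ?Ir \<union> B)"
    unfolding inn by auto
  show ?case
  proof (cases "\<not> big l \<and> \<not> big r")
    case True
    then have I: "?Il = {}" "?Ir = {}" by (simp_all add: inner_not_big)
    have plan: "plan lo hi (Node l p r) = [H]" using True by (simp add: H_def)
    \<comment> \<open>At a lowest non-leaf the order is still \<open>H\<close> below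
      \<open>p\<close> below \<open>lo\<close>, so one query at \<open>H\<close> touches all
      three.\<close>
    have "touched (A \<union> {p} \<union> B) \<rho> H y \<longleftrightarrow> y \<in> {H, p} \<union> set_option lo" for y
    proof (rule touched_left[OF ordp lo])
      show "\<forall>a\<in>set_option lo. \<rho> p < \<rho> a" using lodec by blast
      show "H = p \<or> H \<in> B \<and> (\<forall>y\<in>B. H \<le> y) \<and> \<rho> H < \<rho> p"
        using hi dec ordp(2) by (auto simp: H_def lower_end_def split: option.splits)
      show "\<forall>y\<in>B. \<rho> y \<le> \<rho> H"
        using hi by (auto simp: H_def lower_end_def split: option.splits)
    qed
    moreover have "{H, p} \<union> set_option lo = {p} \<union> N"
      by (auto simp: H_def N_def split: option.splits)
    ultimately have t: "touched (A \<union> {p} \<union> B) \<rho> H y \<longleftrightarrow> y \<in> {p} \<union> N" for y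
      by (simp only:)
    have run: "run (A \<union> set (inner (Node l p r)) \<union> B) m \<rho> (plan lo hi (Node l p r)) =
        (\<lambda>y. if y \<in> {p} \<union> N then Suc m else \<rho> y)"
      unfolding U I plan using t by (simp add: touch_def)
    have "\<rho> z < Suc m \<and> z \<notin> {p} \<union> N" if "z \<in> set_tree l \<union> set_tree r" for z
      using that le AB N bl(3,4) by (auto simp: less_Suc_eq_le)
    then show ?thesis
      unfolding run Let_def using True le N plan AB
      by (auto simp: heap_not_big N_def le_Suc_eq)
  next
    case False
    define ph where "ph = (if big l then plan lo (Some p) l else [p])"
    define ph' where "ph' = (if big r then plan (Some p) hi r @ [H, L] else [L, H])"
    have plan: "plan lo hi (Node l p r) = ph @ ph'"
      using False by (auto simp: ph_def ph'_def H_def L_def Let_def)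
    let ?B = "{p} \<union> ?Ir \<union> B"
    define \<sigma> where "\<sigma> = run (A \<union> ?Il \<union> ?B) m \<rho> ph"
    define k where "k = m + length ph"
    have mk: "m < k" using plan_nonempty[of l lo "Some p"] by (auto simp: k_def ph_def)
    \<comment> \<open>With or without inner nodes on the left, the first phase ends alike:
      \<open>p\<close> and \<open>lo\<close> share the fresh time \<open>k\<close>, and the keys to
      the right of \<open>p\<close> are unchanged. The single query \<open>p\<close> stands in for a
      missing left phase.\<close>
    have st1: "heap_wrt (\<lambda>a z. \<sigma> z < \<sigma> a) l \<and> (\<forall>y\<in>{p} \<union> set_option lo. \<sigma> y = k) \<and>
        (\<forall>y\<in>A \<union> ?Ir \<union> B - set_option lo. \<sigma> y = \<rho> y) \<and> (\<forall>y\<in>set_tree l. \<sigma> y \<le> k)"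
    proof (cases "big l")
      case True
      have ph: "ph = plan lo (Some p) l" using True by (simp add: ph_def)
      have "let \<rho>' = run (A \<union> ?Il \<union> ?B) m \<rho> (plan lo (Some p) l) in
        heap_wrt (\<lambda>a z. \<rho>' z < \<rho>' a) l \<and>
        (\<forall>y\<in>set_option lo \<union> set_option (Some p). \<rho>' y = m + length (plan lo (Some p) l)) \<and>
        (\<forall>y\<in>A \<union> ?B - (set_option lo \<union> set_option (Some p)). \<rho>' y = \<rho> y) \<and>
        (\<forall>y\<in>set_tree l. \<rho>' y \<le> m + length (plan lo (Some p) l))"
      proof (rule Node.IH(1)[OF True bl(1)])
        show "\<forall>a\<in>A. \<forall>x\<in>set_tree l. a < x" using Node.prems(3) by auto
        show "\<forall>x\<in>set_tree l. \<forall>b\<in>?B. x < b"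
          using Node.prems(4) bl(3) Ilp(2) by (auto dest: less_trans)
        show "upper_end \<rho> A lo" by (rule lo)
        show "lower_end \<rho> ?B (Some p)"
          using dec Ilp(2) ordp(2) by (auto simp: lower_end_def intro: less_imp_le)
        show "\<forall>a\<in>set_option lo. \<forall>x\<in>?Il \<union> ?B. \<rho> x < \<rho> a" using lodec by auto
        show "\<forall>x\<in>?Il. \<forall>y\<in>?Il \<union> ?B. x < y \<longrightarrow> \<rho> y < \<rho> x" using dec by auto
        show "\<forall>y\<in>A \<union> set_tree l \<union> ?B. \<rho> y \<le> m" using le sub by auto
      qed
      then have st: "heap_wrt (\<lambda>a z. \<sigma> z < \<sigma> a) l" "\<forall>y\<in>set_option lo \<union> {p}. \<sigma> y = k"
        "\<forall>y\<in>A \<union> ?B - (set_option lo \<union> {p}). \<sigma> y = \<rho> y" "\<forall>y\<in>set_tree l. \<sigma> y \<le> k"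
        unfolding Let_def ph \<sigma>_def k_def option.set by blast+
      have "p \<notin> A \<union> ?Ir \<union> B" using ordp Ilp by auto
      then show ?thesis using st by blast
    next
      case False
      then have I: "?Il = {}" by (simp add: inner_not_big)
      have "touched (A \<union> {p} \<union> (?Ir \<union> B)) \<rho> p y \<longleftrightarrow> y \<in> {p, p} \<union> set_option lo" for y
      proof (rule touched_left[OF ordp(1) _ lo])
        show "\<forall>b\<in>?Ir \<union> B. p < b" using ordp(2) Ilp(2) by auto
        show "\<forall>a\<in>set_option lo. \<rho> p < \<rho> a" using lodec by blast
        show "\<forall>y\<in>?Ir \<union> B. \<rho> y \<le> \<rho> p" using dec ordp(2) Ilp(2) by (auto intro: less_imp_le)
      qed simp
      moreover have "A \<union> {p} \<union> (?Ir \<union> B) = A \<union> ?Il \<union> ?B" using I by auto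
      ultimately have "touched (A \<union> ?Il \<union> ?B) \<rho> p y \<longleftrightarrow> y \<in> {p} \<union> set_option lo" for y
        by (simp only: insert_absorb2)
      then have \<sigma>: "\<sigma> = (\<lambda>y. if y \<in> {p} \<union> set_option lo then k else \<rho> y)"
        using False unfolding \<sigma>_def by (simp add: ph_def k_def touch_def fun_eq_iff)
      have "p \<notin> A \<union> ?Ir \<union> B" using ordp Ilp by auto
      then show ?thesis using False le mk unfolding \<sigma>
        by (auto simp: heap_not_big intro: order_trans less_imp_le)
    qed
    have \<sigma>p: "\<sigma> p = k" and \<sigma>lo: "\<forall>a\<in>set_option lo. \<sigma> a = k"
      and \<sigma>eq: "\<forall>y\<in>A \<union> ?Ir \<union> B - set_option lo. \<sigma> y = \<rho> y" and \<sigma>l: "\<forall>y\<in>set_tree l. \<sigma> y \<le> k"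
      and heapl: "heap_wrt (\<lambda>a z. \<sigma> z < \<sigma> a) l"
      using st1 by auto
    have "\<forall>y\<in>?Ir \<union> B \<union> {p}. p \<le> y" using ordp(2) Ilp(2) by (auto intro: less_imp_le)
    then have loA: "set_option lo \<inter> (?Ir \<union> B \<union> {p}) = {}"
      using upper_endD[OF lo] ordp(1) by (meson disjoint_iff leD subsetD)
    have \<sigma>B: "\<forall>y\<in>?Ir \<union> B. \<sigma> y = \<rho> y \<and> \<sigma> y < k"
    proof
      fix y assume y: "y \<in> ?Ir \<union> B"
      then have "\<sigma> y = \<rho> y" using \<sigma>eq loA by blast
      moreover have "\<rho> y \<le> m" using y le sub by auto
      ultimately show "\<sigma> y = \<rho> y \<and> \<sigma> y < k" using mk by simp
    qed
    have \<sigma>A: "\<sigma> y = \<rho> y \<and> \<rho> y < k" if "y \<in> A - set_option lo" for y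
      using \<sigma>eq le mk that by force
    have \<sigma>A': "\<forall>y\<in>A. \<sigma> y \<le> k" using \<sigma>A \<sigma>lo by (metis DiffI less_imp_le order_refl)
    have lo1: "upper_end \<sigma> A lo"
      using lo \<sigma>A' \<sigma>lo by (auto simp: upper_end_def split: option.splits)
    have hi1: "lower_end \<sigma> B hi"
      using hi \<sigma>B by (auto simp: lower_end_def split: option.splits)
    let ?U2 = "A \<union> ?B"
    \<comment> \<open>The keys \<open>lo\<close> and \<open>p\<close>, both at time
      \<open>k\<close>, now shield the inner keys of \<open>l\<close>, which leave the run.\<close>
    have shut: "shut (A \<union> ?Il \<union> ?B) ?U2 \<sigma>"
    proof (rule shut_remove[OF _ _ lo])
      show "\<forall>a\<in>A. \<forall>x\<in>?Il. a < x" using Node.prems(3) sub by auto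
      show "\<forall>x\<in>?Il. \<forall>b\<in>?B. x < b" using Ilp ordp(2) by (auto dest: less_trans)
      show "lower_end \<rho> ?B (Some p)"
        using dec Ilp(2) ordp(2) by (auto simp: lower_end_def intro: less_imp_le)
      show "\<forall>x\<in>?Il. \<forall>y\<in>set_option lo \<union> set_option (Some p). \<sigma> x \<le> \<sigma> y"
        using \<sigma>l \<sigma>p \<sigma>lo sub by auto
    qed
    have LH: "L \<in> insert p A" "H \<in> insert p B"
      using lo hi by (auto simp: L_def H_def upper_end_def lower_end_def split: option.splits)
    have "set ph' \<subseteq> ?U2"
      using set_plan_subset[of r "Some p" hi] lower_endD[OF hi] LH by (auto simp: ph'_def)
    moreover have U2k: "\<forall>y\<in>?U2. \<sigma> y \<le> k" using \<sigma>A' \<sigma>B \<sigma>p by (auto intro: less_imp_le)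
    ultimately have run: "run (A \<union> set (inner (Node l p r)) \<union> B) m \<rho> (plan lo hi (Node l p r)) =
        run ?U2 k \<sigma> ph'"
      unfolding U plan run_append \<sigma>_def[symmetric] k_def[symmetric]
      by (rule run_shut[OF shut])
    define m' where "m' = m + length (plan lo hi (Node l p r))"
    \<comment> \<open>Here \<tau> is the valuation just before the two finishing queries: the one
      after the right phase, or \<sigma> if there is no such phase.\<close>
    have "\<exists>\<tau>. heap_wrt (\<lambda>a z. \<tau> z < \<tau> a) r \<and> (\<forall>y\<in>set_tree r. \<tau> y < m') \<and>
        (\<forall>y\<in>set_tree l. \<tau> y = \<sigma> y) \<and> (\<forall>y\<in>A \<union> B - N. \<tau> y = \<sigma> y) \<and>
        run ?U2 k \<sigma> ph' = (\<lambda>y. if y \<in> {p} \<union> N then m' else \<tau> y)"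
    proof (cases "big r")
      case True
      define \<tau> where "\<tau> = run ?U2 k \<sigma> (plan (Some p) hi r)"
      define j where "j = k + length (plan (Some p) hi r)"
      have kj: "k < j" using plan_nonempty[OF True, of "Some p" hi] by (simp add: j_def)
      have ordr: "\<forall>a\<in>insert p A. \<forall>x\<in>set_tree r. a < x" "\<forall>x\<in>set_tree r. \<forall>b\<in>B. x < b"
        using Node.prems(3,4) bl(4) by auto
      have U2: "insert p A \<union> ?Ir \<union> B = ?U2" by auto
      have lop: "upper_end \<sigma> (insert p A) (Some p)"
        using ordp(1) \<sigma>A' \<sigma>p by (auto simp: upper_end_def intro: less_imp_le)
      have "let \<rho>' = run (insert p A \<union> ?Ir \<union> B) k \<sigma> (plan (Some p) hi r) in
        heap_wrt (\<lambda>a z. \<rho>' z < \<rho>' a) r \<and>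
        (\<forall>y\<in>set_option (Some p) \<union> set_option hi. \<rho>' y = k + length (plan (Some p) hi r)) \<and>
        (\<forall>y\<in>insert p A \<union> B - (set_option (Some p) \<union> set_option hi). \<rho>' y = \<sigma> y) \<and>
        (\<forall>y\<in>set_tree r. \<rho>' y \<le> k + length (plan (Some p) hi r))"
      proof (rule Node.IH(2)[OF True bl(2) ordr lop hi1])
        show "\<forall>a\<in>set_option (Some p). \<forall>x\<in>?Ir \<union> B. \<sigma> x < \<sigma> a"
          unfolding option.set using \<sigma>p \<sigma>B by blast
        show "\<forall>x\<in>?Ir. \<forall>y\<in>?Ir \<union> B. x < y \<longrightarrow> \<sigma> y < \<sigma> x"
        proof (intro ballI impI)
          fix x y assume xy: "x \<in> ?Ir" "y \<in> ?Ir \<union> B" "x < y"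
          then have "\<rho> y < \<rho> x" using dec by blast
          moreover have "\<sigma> x = \<rho> x" "\<sigma> y = \<rho> y" using \<sigma>B xy by blast+
          ultimately show "\<sigma> y < \<sigma> x" by simp
        qed
        have "\<sigma> y \<le> k" if y: "y \<in> set_tree r" for y
        proof (cases "y \<in> ?Ir")
          case True
          then show ?thesis using U2k by auto
        next
          case False
          \<comment> \<open>Such a \<open>y\<close> is a leaf of \<open>r\<close>, outside the keys
            of the run, so it keeps its old time.\<close>
          have "y \<notin> A \<union> ?Il \<union> ?B"
            using False y AB bl(3,4) sub(1) by (auto dest: less_asym)
          then have "\<sigma> y = \<rho> y" unfolding \<sigma>_def by (rule run_notin)
          then show ?thesis using le y mk by force
        qed
        then show "\<forall>y\<in>insert p A \<union> set_tree r \<union> B. \<sigma> y \<le> k" using U2k by auto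
      qed
      then have st: "heap_wrt (\<lambda>a z. \<tau> z < \<tau> a) r" "\<forall>y\<in>{p} \<union> set_option hi. \<tau> y = j"
        "\<forall>y\<in>insert p A \<union> B - ({p} \<union> set_option hi). \<tau> y = \<sigma> y" "\<forall>y\<in>set_tree r. \<tau> y \<le> j"
        unfolding Let_def U2 \<tau>_def j_def option.set by blast+
      have "\<forall>y\<in>insert p A. y \<le> p" using ordp(1) by (auto intro: less_imp_le)
      then have hiB: "set_option hi \<inter> insert p A = {}"
        using lower_endD[OF hi] ordp(2) by (meson disjoint_iff leD subsetD)
      have \<tau>A: "\<tau> y = \<sigma> y" if "y \<in> A" for y
        using st(3) that hiB ordp(1) by blast
      have \<tau>B: "\<tau> y = \<sigma> y" if "y \<in> B - set_option hi" for y
        using st(3) that ordp(2) by blast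
      have \<tau>B': "\<forall>y\<in>B. \<tau> y \<le> j"
      proof
        fix y assume "y \<in> B"
        then show "\<tau> y \<le> j" using st(2) \<tau>B[of y] \<sigma>B kj by (cases "y \<in> set_option hi") force+
      qed
      let ?U3 = "A \<union> {p} \<union> B"
      have "shut (insert p A \<union> ?Ir \<union> B) (insert p A \<union> B) \<tau>"
      proof (rule shut_remove[OF _ _ lop hi])
        show "\<forall>a\<in>insert p A. \<forall>x\<in>?Ir. a < x" "\<forall>x\<in>?Ir. \<forall>b\<in>B. x < b" using ordr sub by auto
        show "\<forall>x\<in>?Ir. \<forall>y\<in>set_option (Some p) \<union> set_option hi. \<tau> x \<le> \<tau> y"
          using st(2,4) sub by auto
      qed
      then have shut': "shut ?U2 ?U3 \<tau>" unfolding U2 by simp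
      have "run ?U2 k \<sigma> ph' = run ?U2 j \<tau> [H, L]"
        using True unfolding ph'_def \<tau>_def j_def by (simp add: run_append)
      also have "\<dots> = run ?U3 j \<tau> [H, L]"
      proof (rule run_shut[OF shut'])
        show "set [H, L] \<subseteq> ?U3" using LH by auto
        show "\<forall>y\<in>?U3. \<tau> y \<le> j" using \<tau>A \<sigma>A' kj \<tau>B' st(2) by force
      qed
      \<comment> \<open>The right phase leaves \<open>p\<close> and \<open>hi\<close> tied at
        \<open>j\<close> with \<open>A\<close> below, whence the order \<open>[H, L]\<close>.
        Without it, \<open>p\<close> and \<open>lo\<close> are tied with \<open>B\<close> below,
        whence \<open>[L, H]\<close>.\<close>
      also have "\<dots> = (\<lambda>y. if y \<in> {p} \<union> set_option lo \<union> set_option hi then j + 2 else \<tau> y)"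
        unfolding H_def L_def
      proof (rule finish_right[OF ordp])
        show "upper_end \<tau> A lo" using lo1 \<tau>A by (auto simp: upper_end_def split: option.splits)
        show "lower_end \<tau> B hi" using hi \<tau>B' st(2) by (auto simp: lower_end_def split: option.splits)
        show "\<tau> p = j" "\<forall>b\<in>set_option hi. \<tau> b = j" using st(2) by auto
        show "\<forall>y\<in>B. \<tau> y \<le> j" by (rule \<tau>B')
        show "\<forall>y\<in>A. \<tau> y < j" using \<tau>A \<sigma>A' kj by force
      qed
      also have "{p} \<union> set_option lo \<union> set_option hi = {p} \<union> N" by (auto simp: N_def)
      also have j: "j + 2 = m'"
        using True unfolding m'_def plan by (simp add: j_def k_def ph'_def)
      finally have fin: "run ?U2 k \<sigma> ph' = (\<lambda>y. if y \<in> {p} \<union> N then m' else \<tau> y)" .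
      have "\<tau> y = \<sigma> y" if "y \<in> set_tree l" for y
      proof -
        have "y \<notin> ?U2" using that AB bl(3) Ilp(2) by (auto dest: less_asym)
        then show ?thesis unfolding \<tau>_def by (rule run_notin)
      qed
      moreover have "\<forall>y\<in>A \<union> B - N. \<tau> y = \<sigma> y" using \<tau>A \<tau>B by (auto simp: N_def)
      moreover have "\<forall>y\<in>set_tree r. \<tau> y < m'" using st(4) j by force
      ultimately show ?thesis using fin st(1) by blast
    next
      case False
      then have I: "?Ir = {}" by (simp add: inner_not_big)
      have "run ?U2 k \<sigma> ph' = run (A \<union> {p} \<union> B) k \<sigma> [L, H]"
        using False I by (simp add: ph'_def)
      also have "\<dots> = (\<lambda>y. if y \<in> {p} \<union> set_option lo \<union> set_option hi then k + 2 else \<sigma> y)"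
        unfolding H_def L_def
        by (rule finish_left[OF ordp lo1 hi1 \<sigma>p \<sigma>lo \<sigma>A']) (use \<sigma>B in blast)
      also have "{p} \<union> set_option lo \<union> set_option hi = {p} \<union> N" by (auto simp: N_def)
      also have k: "k + 2 = m'" using False unfolding m'_def plan by (simp add: k_def ph'_def)
      finally have fin: "run ?U2 k \<sigma> ph' = (\<lambda>y. if y \<in> {p} \<union> N then m' else \<sigma> y)" .
      have "\<sigma> y < m'" if y: "y \<in> set_tree r" for y
      proof -
        have "y \<notin> A \<union> ?Il \<union> ?B"
          using I y AB bl(3,4) sub(1) by (auto dest: less_asym)
        then have "\<sigma> y = \<rho> y" unfolding \<sigma>_def by (rule run_notin)
        then show ?thesis using le y mk k by force
      qed
      then show ?thesis using fin False heap_not_big[OF False] by blast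
    qed
    then obtain \<tau> where \<tau>: "heap_wrt (\<lambda>a z. \<tau> z < \<tau> a) r" "\<forall>y\<in>set_tree r. \<tau> y < m'"
      "\<forall>y\<in>set_tree l. \<tau> y = \<sigma> y" "\<forall>y\<in>A \<union> B - N. \<tau> y = \<sigma> y"
      and fin: "run ?U2 k \<sigma> ph' = (\<lambda>y. if y \<in> {p} \<union> N then m' else \<tau> y)" by blast
    define f where "f = (\<lambda>y. if y \<in> {p} \<union> N then m' else \<tau> y)"
    have km': "k < m'" unfolding m'_def plan by (simp add: k_def ph'_def)
    have out: "z \<notin> {p} \<union> N" if "z \<in> set_tree l \<union> set_tree r" for z
      using that AB N bl(3,4) by auto
    have fz: "f z = \<tau> z" if "z \<in> set_tree l \<union> set_tree r" for z
      using out[OF that] by (simp add: f_def)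
    have lt: "\<tau> z < m'" if "z \<in> set_tree l \<union> set_tree r" for z
      using that \<tau>(2,3) \<sigma>l km' by force
    have "heap_wrt (\<lambda>a z. f z < f a) l"
      by (rule heap_mono[OF heapl]) (simp only: fz UnI1 \<tau>(3))
    moreover have "heap_wrt (\<lambda>a z. f z < f a) r"
      by (rule heap_mono[OF \<tau>(1)]) (simp only: fz UnI2)
    moreover have "\<forall>z\<in>set_tree l \<union> set_tree r. f z < f p"
      using fz lt by (simp add: f_def)
    ultimately have "heap_wrt (\<lambda>a z. f z < f a) (Node l p r)" by simp
    moreover have "\<forall>y\<in>N. f y = m'" by (simp add: f_def)
    moreover have "\<forall>y\<in>A \<union> B - N. f y = \<rho> y"
    proof
      fix y assume y: "y \<in> A \<union> B - N"
      then have "f y = \<sigma> y" using \<tau>(4) ordp by (auto simp: f_def)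
      also have "\<dots> = \<rho> y" using y \<sigma>eq by (auto simp: N_def)
      finally show "f y = \<rho> y" .
    qed
    moreover have "\<forall>y\<in>set_tree (Node l p r). f y \<le> m'"
      using lt by (auto simp: f_def intro: less_imp_le)
    ultimately show ?thesis
      unfolding Let_def run fin f_def[symmetric] N_def[symmetric] m'_def[symmetric] by blast
  qed
qed simp

section \<open>Length of the query sequence\<close>

lemma sorted_inner: "bst t \<Longrightarrow> sorted_wrt (<) (inner t)"
proof (induction t)
  case (Node l a r)
  have "\<forall>x\<in>set (inner l). x < a" "\<forall>x\<in>set (inner r). a < x"
    using Node.prems set_inner_subset[of l] set_inner_subset[of r] by auto
  then show ?case using Node by (auto simp: sorted_wrt_append dest: less_trans)
qed simp

fun singles :: "'a tree \<Rightarrow> nat" where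
  "singles Leaf = 0"
| "singles (Node l a r) = (if l = Leaf \<and> r = Leaf then 1 else singles l + singles r)"

text \<open>The leaves of the tree that remains when all leaves are cut off.\<close>

fun stems :: "'a tree \<Rightarrow> nat" where
  "stems Leaf = 0"
| "stems (Node l a r) =
     (if l = Leaf \<and> r = Leaf then 0 else if \<not> big l \<and> \<not> big r then 1 else stems l + stems r)"

lemma size_eq_inner_singles: "size t = length (inner t) + singles t"
  by (induction t) auto

lemma not_big_cases: "\<not> big t \<Longrightarrow> t = Leaf \<or> (\<exists>a. t = Node Leaf a Leaf)"
  by (cases t) (auto simp: not_le less_Suc_eq numeral_2_eq_2 eq_size_0)

lemma stems_not_big: "\<not> big t \<Longrightarrow> stems t = 0"
  using not_big_cases[of t] by auto

text \<open>Every lowest non-leaf has a leaf as a child, and distinct ones have distinct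
  leaves.\<close>

lemma stems_le_singles: "stems t \<le> singles t"
proof (induction t)
  case (Node l a r)
  then show ?case using not_big_cases[of l] not_big_cases[of r] by auto
qed simp

lemma stems_pos: "big t \<Longrightarrow> 1 \<le> stems t"
proof (induction t)
  case (Node l a r)
  then show ?case by (cases "big l"; cases "big r") auto
qed simp

text \<open>A node with two big subtrees costs two queries but merges two summands
  \<open>+ 1\<close>; one with only a right big subtree costs three; a lowest non-leaf costs one. In
  these cases the induction step is tight; with only a left big subtree one query is spare.\<close>

lemma length_plan: "big t \<Longrightarrow> length (plan lo hi t) + 3 * stems t \<le> 3 * length (inner t) + 1"
proof (induction t arbitrary: lo hi)
  case (Node l p r)
  have inn: "inner (Node l p r) = inner l @ p # inner r" using Node.prems by (rule inner_big)
  have st: "stems (Node l p r) = (if \<not> big l \<and> \<not> big r then 1 else stems l + stems r)"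
    using Node.prems by auto
  have l: "length (plan lo (Some p) l) + 3 * stems l \<le> 3 * length (inner l) + 1" if "big l"
    using Node.IH(1)[OF that] .
  have r: "length (plan (Some p) hi r) + 3 * stems r \<le> 3 * length (inner r) + 1" if "big r"
    using Node.IH(2)[OF that] .
  show ?case
    unfolding st inn using l r
    by (cases "big l"; cases "big r") (simp_all add: Let_def stems_not_big)
qed simp

lemma big_height: "big t \<Longrightarrow> 2 \<le> height t"
proof (cases t)
  case (Node l a r)
  assume "big t"
  then have "l \<noteq> Leaf \<or> r \<noteq> Leaf" using Node by auto
  then have "1 \<le> max (height l) (height r)" by (cases l; cases r) auto
  then show ?thesis using Node by simp
qed simp

text \<open>Cutting off the leaves twice removes the leaves and then the lowest non-leaves. What
  remains has height at most \<open>height t - 2\<close>, hence fewer than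
  \<open>2 ^ (height t - 2)\<close> nodes.\<close>

lemma length_inner_le: "big t \<Longrightarrow> length (inner t) + 1 \<le> 2 ^ (height t - 2) + stems t"
proof (induction t)
  case (Node l a r)
  let ?h = "height (Node l a r)"
  have inn: "inner (Node l a r) = inner l @ a # inner r" using Node.prems by (rule inner_big)
  have st: "stems (Node l a r) = (if \<not> big l \<and> \<not> big r then 1 else stems l + stems r)"
    using Node.prems by auto
  show ?case
  proof (cases "\<not> big l \<and> \<not> big r")
    case True
    then show ?thesis unfolding inn st by (simp add: inner_not_big)
  next
    case False
    then have "3 \<le> ?h" using big_height[of l] big_height[of r] by auto
    then obtain h where h: "?h = h + 3" using le_Suc_ex by (metis add.commute)
    \<comment> \<open>The exponent \<open>h\<close> is three less than the height, so a child has
      height at most \<open>h + 2\<close>. The bound also covers children that are not big, where it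
      reads \<open>1 \<le> 2 ^ h\<close>.\<close>
    have c: "length (inner s) + 1 \<le> 2 ^ h + stems s" if "s = l \<or> s = r" for s
    proof (cases "big s")
      case True
      then have "length (inner s) + 1 \<le> 2 ^ (height s - 2) + stems s" using Node.IH that by auto
      moreover have "(2::nat) ^ (height s - 2) \<le> 2 ^ h"
        by (rule power_increasing) (use that h in auto)
      ultimately show ?thesis by linarith
    qed (simp add: inner_not_big Suc_le_eq trans_less_add1)
    have "(2::nat) ^ (?h - 2) = 2 ^ h + 2 ^ h" unfolding h by simp
    then show ?thesis unfolding inn st using c[of l] c[of r] False by auto
  qed
qed simp

section \<open>The complete query sequence\<close>

lemma length_sweep: "length (sweep us) = 2 * length us"
  by (induction us) (auto simp: sweep_def)

lemma set_sweep: "set (sweep us) = set us"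
  by (auto simp: sweep_def)

text \<open>With at most one key the key set determines the tree, and the quadratic bound leaves no
  room for queries on one key.\<close>

definition seq :: "'a::linorder tree \<Rightarrow> 'a list" where
  "seq t = (if big t then sweep (inner t) @ plan None None t else [])"

lemma set_seq: "set (seq t) \<subseteq> set_tree t"
  using set_plan_subset[of t None None] set_inner_subset[of t] by (auto simp: seq_def set_sweep)

lemma seq_heap:
  assumes "bst t" "\<forall>z\<in>set_tree t. \<rho> z \<le> m"
  shows "heap_wrt (\<lambda>a z. run (set_tree t) m \<rho> (seq t) z < run (set_tree t) m \<rho> (seq t) a) t"
proof (cases "big t")
  case True
  let ?K = "set_tree t" and ?U = "set (inner t)"
  define \<sigma> where "\<sigma> = run ?K m \<rho> (sweep (inner t))"
  define k where "k = m + length (sweep (inner t))"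
  have "inner t \<noteq> []" using True by (cases t) auto
  from sweep_shut[OF this sorted_inner[OF assms(1)] set_inner_subset assms(2)]
  have shut: "shut ?K ?U \<sigma>" and dec: "\<forall>x\<in>?U. \<forall>y\<in>?U. x < y \<longrightarrow> \<sigma> y < \<sigma> x"
    by (auto simp: \<sigma>_def)
  have le: "\<forall>y\<in>?K. \<sigma> y \<le> k" using run_le[OF assms(2)] by (simp add: \<sigma>_def k_def)
  have "run ?K m \<rho> (seq t) = run ?K k \<sigma> (plan None None t)"
    using True by (simp add: seq_def run_append \<sigma>_def k_def)
  also have "\<dots> = run ?U k \<sigma> (plan None None t)"
    by (rule run_shut[OF shut]) (use set_plan_subset[OF True, of None None] le set_inner_subset[of t] in auto)
  finally have "run ?K m \<rho> (seq t) = run ({} \<union> ?U \<union> {}) k \<sigma> (plan None None t)" by simp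
  moreover have "let \<rho>' = run ({} \<union> ?U \<union> {}) k \<sigma> (plan None None t) in
    heap_wrt (\<lambda>a z. \<rho>' z < \<rho>' a) t \<and>
    (\<forall>y\<in>set_option None \<union> set_option None. \<rho>' y = k + length (plan None None t)) \<and>
    (\<forall>y\<in>{} \<union> {} - (set_option None \<union> set_option None). \<rho>' y = \<sigma> y) \<and>
    (\<forall>y\<in>set_tree t. \<rho>' y \<le> k + length (plan None None t))"
    by (rule plan_heap[OF True assms(1)]) (use dec le in \<open>auto simp: upper_end_def lower_end_def\<close>)
  ultimately show ?thesis by (simp add: Let_def)
next
  case False
  then show ?thesis by (rule heap_not_big)
qed

lemma length_seq:
  assumes "big t"
  shows "length (seq t) + 3 * stems t \<le> 5 * length (inner t) + 1"
  using length_plan[OF assms, of None None] assms by (simp add: seq_def length_sweep)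

text \<open>With \<open>I\<close>, \<open>L\<close>, \<open>P\<close> the numbers of inner nodes,
  leaves and stems, the height bound and the hypothesis give \<open>I + 2 \<le> L + 2 * P\<close>.
  Hence \<open>5 * I + 1 - 3 * P\<close> is at most \<open>3 * I + 2 * L + P - 3\<close>, and
  \<open>P \<le> L\<close> finishes.\<close>

lemma length_seq_shallow:
  assumes "2 ^ (height t - 1) \<le> size t"
  shows "length (seq t) \<le> 3 * size t"
proof (cases "big t")
  case True
  obtain h where h: "height t = h + 2"
    using big_height[OF True] le_Suc_ex by (metis add.commute)
  have "length (inner t) + 1 \<le> 2 ^ h + stems t"
    using length_inner_le[OF True] h by simp
  moreover have "2 * 2 ^ h \<le> length (inner t) + singles t"
    using assms h size_eq_inner_singles[of t] by simp
  ultimately show ?thesis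
    using length_seq[OF True] stems_le_singles[of t] size_eq_inner_singles[of t] by linarith
qed (simp add: seq_def)

lemma length_seq_le_quadratic: "2 * length (seq t) \<le> 3 * size t * (size t - 1)"
proof (cases "big t")
  case True
  have "length (inner t) + 1 \<le> size t"
    using stems_pos[OF True] stems_le_singles[of t] size_eq_inner_singles[of t] by linarith
  \<comment> \<open>From at most \<open>n - 1\<close> inner nodes and at least one stem:
    \<open>5 * (n - 1) + 1 - 3\<close>.\<close>
  then have *: "length (seq t) + 7 \<le> 5 * size t"
    using length_seq[OF True] stems_pos[OF True] by linarith
  obtain k where k: "size t = k + 2" using True le_Suc_ex by (metis add.commute)
  have "k \<le> k * k" by (cases k) auto
  moreover have "3 * size t * (size t - 1) = 3 * (k * k) + 9 * k + 6"
    unfolding k by (simp add: algebra_simps)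
  ultimately show ?thesis using * k by linarith
qed (simp add: seq_def)

theorem theorem6:
  fixes T :: "'a::linorder tree" and n :: nat
  assumes "bst T" and "size T = n" and "n \<ge> 1"
  shows "\<exists>S. set S \<subseteq> set_tree T \<and>
           real (length S) \<le> min (3 * real n * (real (depth_tree T) - real_of_int \<lfloor>log 2 (real n)\<rfloor> + 1))
                                  (3 / 2 * real n * (real n - 1)) \<and>
           (\<forall>T0 Y. bst T0 \<and> set_tree T0 = set_tree T \<and> set Y \<subseteq> set_tree T
               \<longrightarrow> gf_serve T0 (S @ Y) (length S) = T)"
proof (intro exI[of _ "seq T"] conjI min.boundedI allI impI)
  show "set (seq T) \<subseteq> set_tree T" by (rule set_seq)
next
  define d where "d = depth_tree T"
  have h: "height T = Suc d" using assms by (cases T) (auto simp: d_def depth_tree_def)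
  have "n < 2 ^ Suc d" using size1_height[of T] assms(2) h by (simp add: size1_size)
  then have "real n < 2 ^ Suc d" by (metis of_nat_less_iff of_nat_numeral of_nat_power)
  then have "log 2 (real n) < real (Suc d)"
    using assms(3) by (simp add: log_less_iff powr_realpow del: power_Suc of_nat_Suc)
  then have le: "\<lfloor>log 2 (real n)\<rfloor> \<le> int d" by linarith
  have "real (length (seq T)) \<le> 3 * real n * (real d - real_of_int \<lfloor>log 2 (real n)\<rfloor> + 1)"
  \<comment> \<open>The factor of \<open>3 * n\<close> is 1 exactly when
    \<open>2 ^ d \<le> n\<close>, where the sharp bound is needed. Otherwise it is at least 2, and
    the crude bound \<open>6 * n\<close> suffices.\<close>
  proof (cases "\<lfloor>log 2 (real n)\<rfloor> = int d")
    case True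
    then have "real d \<le> log 2 (real n)" by linarith
    then have "2 ^ d \<le> real n"
      using assms(3) by (simp add: le_log_iff powr_realpow)
    then have "2 ^ d \<le> n" by (metis of_nat_le_iff of_nat_numeral of_nat_power)
    then have "length (seq T) \<le> 3 * n"
      using length_seq_shallow[of T] assms h by simp
    then have "real (length (seq T)) \<le> 3 * real n" by linarith
    then show ?thesis using True by simp
  next
    case False
    then have "2 \<le> real d - real_of_int \<lfloor>log 2 (real n)\<rfloor> + 1" using le by linarith
    then have "3 * real n * 2 \<le> 3 * real n * (real d - real_of_int \<lfloor>log 2 (real n)\<rfloor> + 1)"
      by (intro mult_left_mono) auto
    moreover have "length (seq T) \<le> 6 * n"
      using length_seq[of T] stems_pos[of T] size_eq_inner_singles[of T] assms
      by (cases "big T") (auto simp: seq_def)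
    ultimately show ?thesis by linarith
  qed
  then show "real (length (seq T)) \<le> 3 * real n * (real (depth_tree T) - real_of_int \<lfloor>log 2 (real n)\<rfloor> + 1)"
    by (simp add: d_def)
next
  have "real (2 * length (seq T)) \<le> real (3 * n * (n - 1))"
    using length_seq_le_quadratic[of T] assms(2) by (simp only: of_nat_le_iff)
  then show "real (length (seq T)) \<le> 3 / 2 * real n * (real n - 1)"
    using assms(3) by (simp add: of_nat_diff)
next
  fix T0 :: "'a tree" and Y
  assume "bst T0 \<and> set_tree T0 = set_tree T \<and> set Y \<subseteq> set_tree T"
  then show "gf_serve T0 (seq T @ Y) (length (seq T)) = T"
    using gf_serve_eq[OF assms(1) seq_heap[OF assms(1)]] by blast
qed

end
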